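(* Let $\boldsymbol{s}$ be a mutation class of seeds, and assume that there exists a filling set $\Lambda\subset\mathcal{U}^+_{\boldsymbol{s}}$. Then any finite subgroup $G\subset\Gamma_{\boldsymbol{s}}$ of the cluster modular group has a fixed point in $\mathcal{A}_{\boldsymbol{s}}(\mathbb{R}_{>0})$, i.e. there is $x\in\mathcal{A}_{\boldsymbol{s}}(\mathbb{R}_{>0})$ with $\gamma(x)=x$ for all $\gamma\in G$. In particular, $G$ also has a fixed point in $p(\mathcal{A}_{\boldsymbol{s}}(\mathbb{R}_{>0}))\subset\mathcal{X}_{\boldsymbol{s}}(\mathbb{R}_{>0})$, where $p$ is the ensemble map.
   Context: Seeds. Fix a finite set $I$, $n=|I|$, and positive integers $(d_i)_{i\in I}$. Let $\mathcal{F}_A,\mathcal{F}_X$ be fields isomorphic to the rational function field over $\mathbb{Q}$ in $n$ variables. A seed $\mathbf{i}=(\varepsilon,\mathbf{A},\mathbf{X})$ consists of an integer matrix $\varepsilon=(\varepsilon_{ij})_{i,j\in I}$ (exchange matrix) with $(\varepsilon_{ij}d_j)$ skew-symmetric, a tuple $\mathbf{A}=(A_i)_{i\in I}$ of free generators of the field $\mathcal{F}_A$ and a tuple $\mathbf{X}=(X_i)_{i\in I}$ of free generators of $\mathcal{F}_X$. With $[x]_+=\max\{x,0\}$, the mutation $\mu_k(\mathbf{i})=(\varepsilon',\mathbf{A}',\mathbf{X}')$, $k\in I$, is given by: $\varepsilon'_{ij}=-\varepsilon_{ij}$ if $i=k$ or $j=k$, and $\varepsilon'_{ij}=\varepsilon_{ij}+[\varepsilon_{ik}]_+[\varepsilon_{kj}]_+-[-\varepsilon_{ik}]_+[-\varepsilon_{kj}]_+$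 otherwise; $A'_k=A_k^{-1}\big(\prod_j A_j^{[\varepsilon_{kj}]_+}+\prod_j A_j^{[-\varepsilon_{kj}]_+}\big)$, $A'_i=A_i$ for $i\ne k$; $X'_k=X_k^{-1}$, $X'_i=X_i(1+X_k^{-\mathrm{sgn}(\varepsilon_{ik})})^{-\varepsilon_{ik}}$ for $i\neq k$ (so $X_i'=X_i$ if $\varepsilon_{ik}=0$). Two seeds are mutation-equivalent if related by a sequence of mutations and simultaneous relabelings by permutations of $I$; an equivalence class $\boldsymbol{s}$ is a mutation class. The data of $\mathbf{i}\in\boldsymbol{s}$ are written $\varepsilon^{\mathbf{i}},A_j^{\mathbf{i}},X_j^{\mathbf{i}}$. Upper cluster algebra. $\mathcal{U}_{\boldsymbol{s}}=\bigcap_{\mathbf{i}\in\boldsymbol{s}}\mathbb{Z}[(A_j^{\mathbf{i}})^{\pm1}\mid j\in I]\subset\mathcal{F}_A$, and $\mathcal{U}^+_{\boldsymbol{s}}\subset\mathcal{U}_{\boldsymbol{s}}$ is the set of (nonzero) elements whose Laurent expression in $(A_j^{\mathbf{i}})_j$ has positive coefficients for every $\mathbf{i}\in\boldsymbol{s}$. Cluster manifolds. $\mathcal{A}_{\boldsymbol{s}}(\mathbb{R}_{>0})$ is the real-analytic manifold with global charts $\psi_{\mathbf{i}}=(A_j^{\mathbf{i}})_{j}:\mathcal{A}_{\boldsymbol{s}}(\mathbb{R}_{>0})\xrightarrow{\sim}\mathbb{R}_{>0}^I$, $\mathbf{i}\in\boldsymbol{s}$, whose transition maps for $\mathbf{i}'=\mu_k(\mathbf{i})$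 are given by $A_k^{\mathbf{i}'}=(A_k^{\mathbf{i}})^{-1}\big(\prod_j (A_j^{\mathbf{i}})^{[\varepsilon^{\mathbf{i}}_{kj}]_+}+\prod_j (A_j^{\mathbf{i}})^{[-\varepsilon^{\mathbf{i}}_{kj}]_+}\big)$, $A_i^{\mathbf{i}'}=A_i^{\mathbf{i}}$ for $i\ne k$ (and by permutations of coordinates for relabelings); $\mathcal{X}_{\boldsymbol{s}}(\mathbb{R}_{>0})$ is defined likewise with charts $(X_j^{\mathbf{i}})_j$ and the formulas $X_k^{\mathbf{i}'}=(X_k^{\mathbf{i}})^{-1}$, $X_i^{\mathbf{i}'}=X_i^{\mathbf{i}}(1+(X_k^{\mathbf{i}})^{-\mathrm{sgn}(\varepsilon^{\mathbf{i}}_{ik})})^{-\varepsilon^{\mathbf{i}}_{ik}}$ for $i\ne k$. Cluster modular group. $\Gamma_{\boldsymbol{s}}$ is the group of permutations $\phi$ of the set $\boldsymbol{s}$ of seeds that preserve exchange matrices ($\varepsilon^{\phi(\mathbf{i})}=\varepsilon^{\mathbf{i}}$) and commute with all mutations $\mu_k$ and all relabelings. It acts on $\mathcal{A}_{\boldsymbol{s}}(\mathbb{R}_{>0})$ by $A_j^{\mathbf{i}}(\phi(g))=A_j^{\phi^{-1}(\mathbf{i})}(g)$ and on $\mathcal{X}_{\boldsymbol{s}}(\mathbb{R}_{>0})$ by $X_j^{\mathbf{i}}(\phi(g))=X_j^{\phi^{-1}(\mathbf{i})}(g)$. Ensemble map. $p:\mathcal{A}_{\boldsymbol{s}}(\mathbb{R}_{>0})\to\mathcal{X}_{\boldsymbol{s}}(\mathbb{R}_{>0})$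 is the $\Gamma_{\boldsymbol{s}}$-equivariant map given in every seed by $p^*X_k^{\mathbf{i}}=\prod_{j}(A_j^{\mathbf{i}})^{\varepsilon^{\mathbf{i}}_{kj}}$. Filling sets. For $F\in\mathcal{U}_{\boldsymbol{s}}$ let $F|_{\mathbf{i}}=\sum_{\alpha\in\mathbb{Z}^n}c_\alpha\prod_j (A_j^{\mathbf{i}})^{\alpha_j}$ be its Laurent expression, $\mathrm{Supp}(F|_{\mathbf{i}})=\{\alpha\mid c_\alpha\neq0\}$, $\mathrm{Slope}(F|_{\mathbf{i}})=\mathrm{span}_{\mathbb{R}}\{\alpha-\beta\mid\alpha,\beta\in\mathrm{Supp}(F|_{\mathbf{i}})\}\subset\mathbb{R}^n$. A filling set is a finite subset $\Lambda\subset\mathcal{U}^+_{\boldsymbol{s}}$ such that for some $\mathbf{i}\in\boldsymbol{s}$: (1) there is a subset $S\subset\bigcup_{F\in\Lambda}\mathrm{Supp}(F|_{\mathbf{i}})$ whose convex hull is full-dimensional in $\mathbb{R}^n$ and contains $0$ in its interior; (2) $\mathrm{Slope}(F|_{\mathbf{i}})\subset(\ker\varepsilon^{\mathbf{i}})^\perp$ for all $F\in\Lambda$, and $\mathrm{span}_{\mathbb{R}}\bigcup_{F\in\Lambda}\mathrm{Slope}(F|_{\mathbf{i}})=(\ker\varepsilon^{\mathbf{i}})^\perp$. Here $\ker\varepsilon^{\mathbf{i}}=\{\beta\in\mathbb{R}^I\mid\sum_j\varepsilon^{\mathbf{i}}_{kj}\beta_j=0\ \forall k\}$ and $\perp$ is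 taken for the standard inner product. *)

theory Defs
  imports "HOL-Analysis.Analysis" "HOL-Algebra.Bij" "HOL-Library.Poly_Mapping"
begin

section \<open>Free generators and Laurent polynomials\<close>

definition poly_eval :: "(('i \<Rightarrow> nat) \<Rightarrow>\<^sub>0 rat) \<Rightarrow> ('i::finite \<Rightarrow> 'a) \<Rightarrow> 'a::field_char_0" where
  "poly_eval P A = (\<Sum>m\<in>Poly_Mapping.keys P. of_rat (Poly_Mapping.lookup P m) * (\<Prod>j\<in>UNIV. A j ^ m j))"

definition laurent_eval :: "(('i \<Rightarrow> int) \<Rightarrow>\<^sub>0 int) \<Rightarrow> ('i::finite \<Rightarrow> 'a) \<Rightarrow> 'a::field" where
  "laurent_eval c A = (\<Sum>\<alpha>\<in>Poly_Mapping.keys c. of_int (Poly_Mapping.lookup c \<alpha>) * (\<Prod>j\<in>UNIV. A j powi \<alpha> j))"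

definition is_subfield :: "'a::field set \<Rightarrow> bool" where
  "is_subfield K \<longleftrightarrow> 0 \<in> K \<and> 1 \<in> K \<and>
     (\<forall>x\<in>K. \<forall>y\<in>K. x + y \<in> K \<and> x * y \<in> K) \<and> (\<forall>x\<in>K. - x \<in> K \<and> inverse x \<in> K)"

text \<open>A tuple of free generators exhibits the whole type \<open>'a\<close> as a field of rational functions
  over the rationals in the variables \<open>A i\<close>. In particular, a field of characteristic zero has
  such a tuple indexed by \<open>'i\<close> iff it is isomorphic to the rational function field in
  \<open>CARD('i)\<close> variables.\<close>

definition free_generators :: "('i::finite \<Rightarrow> 'a::field_char_0) \<Rightarrow> bool" where
  "free_generators A \<longleftrightarrow> (\<forall>P. poly_eval P A = 0 \<longrightarrow> P = 0) \<and> is_subfield hull (range A) = UNIV"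


section \<open>Seeds and mutations\<close>

datatype ('i, 'a, 'x) seed =
  Seed (exmat: "'i \<Rightarrow> 'i \<Rightarrow> int") (Avar: "'i \<Rightarrow> 'a") (Xvar: "'i \<Rightarrow> 'x")

definition seeds :: "('i::finite \<Rightarrow> nat) \<Rightarrow> ('i, 'a::field_char_0, 'x::field_char_0) seed set" where
  "seeds d = {\<ii>. (\<forall>i j. exmat \<ii> i j * int (d j) = - (exmat \<ii> j i * int (d i))) \<and>
                 free_generators (Avar \<ii>) \<and> free_generators (Xvar \<ii>)}"

definition pos_part :: "int \<Rightarrow> int" where
  "pos_part x = max x 0"

definition mut_mat :: "'i \<Rightarrow> ('i \<Rightarrow> 'i \<Rightarrow> int) \<Rightarrow> 'i \<Rightarrow> 'i \<Rightarrow> int" where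
  "mut_mat k \<epsilon> = (\<lambda>i j. if i = k \<or> j = k then - \<epsilon> i j
     else \<epsilon> i j + pos_part (\<epsilon> i k) * pos_part (\<epsilon> k j)
                - pos_part (- \<epsilon> i k) * pos_part (- \<epsilon> k j))"

text \<open>The exchange relations are stated over an arbitrary field, so that they serve both for the
  cluster variables and for the real coordinates on the cluster manifolds.\<close>

definition mut_A :: "'i \<Rightarrow> ('i \<Rightarrow> 'i \<Rightarrow> int) \<Rightarrow> ('i::finite \<Rightarrow> 'a::field) \<Rightarrow> 'i \<Rightarrow> 'a" where
  "mut_A k \<epsilon> A = (\<lambda>i. if i = k
     then inverse (A k) * ((\<Prod>j\<in>UNIV. A j powi pos_part (\<epsilon> k j)) + (\<Prod>j\<in>UNIV. A j powi pos_part (- \<epsilon> k j)))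
     else A i)"

definition mut_X :: "'i \<Rightarrow> ('i \<Rightarrow> 'i \<Rightarrow> int) \<Rightarrow> ('i \<Rightarrow> 'x::field) \<Rightarrow> 'i \<Rightarrow> 'x" where
  "mut_X k \<epsilon> X = (\<lambda>i. if i = k then inverse (X k)
     else X i * (1 + X k powi (- sgn (\<epsilon> i k))) powi (- \<epsilon> i k))"

definition mutate :: "'i \<Rightarrow> ('i::finite, 'a::field, 'x::field) seed \<Rightarrow> ('i, 'a, 'x) seed" where
  "mutate k \<ii> = Seed (mut_mat k (exmat \<ii>)) (mut_A k (exmat \<ii>) (Avar \<ii>)) (mut_X k (exmat \<ii>) (Xvar \<ii>))"

definition relabel :: "('i \<Rightarrow> 'i) \<Rightarrow> ('i, 'a, 'x) seed \<Rightarrow> ('i, 'a, 'x) seed" where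
  "relabel \<sigma> \<ii> = Seed (\<lambda>i j. exmat \<ii> (\<sigma> i) (\<sigma> j)) (Avar \<ii> \<circ> \<sigma>) (Xvar \<ii> \<circ> \<sigma>)"

text \<open>Mutations and relabelings act invertibly (\<open>mutate k\<close> is an involution on \<open>seeds d\<close>), so the
  reflexive-transitive closure is an equivalence relation on \<open>seeds d\<close>. As \<open>d\<close> is fixed, a
  relabeling is admitted only if it leads to a seed for the same \<open>d\<close>.\<close>

definition mutation_equiv ::
    "('i::finite \<Rightarrow> nat) \<Rightarrow> (('i, 'a::field_char_0, 'x::field_char_0) seed) rel" where
  "mutation_equiv d =
     {(\<ii>, \<jj>). \<ii> \<in> seeds d \<and> \<jj> \<in> seeds d \<and> ((\<exists>k. \<jj> = mutate k \<ii>) \<or> (\<exists>\<sigma>. bij \<sigma> \<and> \<jj> = relabel \<sigma> \<ii>))}\<^sup>*"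

definition mutation_classes ::
    "('i::finite \<Rightarrow> nat) \<Rightarrow> ('i, 'a::field_char_0, 'x::field_char_0) seed set set" where
  "mutation_classes d = seeds d // mutation_equiv d"


section \<open>The upper cluster algebra\<close>

definition upper_cluster_algebra :: "('i::finite, 'a::field, 'x) seed set \<Rightarrow> 'a set" where
  "upper_cluster_algebra s = (\<Inter>\<ii>\<in>s. range (\<lambda>c. laurent_eval c (Avar \<ii>)))"

text \<open>The Laurent expression is unique because \<open>Avar \<ii>\<close> is algebraically independent.\<close>

definition laurent_expr :: "('i::finite, 'a::field, 'x) seed \<Rightarrow> 'a \<Rightarrow> (('i \<Rightarrow> int) \<Rightarrow>\<^sub>0 int)" where
  "laurent_expr \<ii> F = (THE c. laurent_eval c (Avar \<ii>) = F)"

definition upper_cluster_algebra_pos :: "('i::finite, 'a::field, 'x) seed set \<Rightarrow> 'a set" where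
  "upper_cluster_algebra_pos s = {F \<in> upper_cluster_algebra s. F \<noteq> 0 \<and>
     (\<forall>\<ii>\<in>s. \<forall>\<alpha>\<in>Poly_Mapping.keys (laurent_expr \<ii> F). 0 < Poly_Mapping.lookup (laurent_expr \<ii> F) \<alpha>)}"


section \<open>Cluster manifolds and the ensemble map\<close>

text \<open>A point of the manifold glued from the charts \<open>\<ii> \<in> s\<close> is represented by the family of its
  coordinate tuples in all charts, that is, by a family of points of the positive orthant which is
  compatible with the transition maps; the chart of the seed \<open>\<ii>\<close> is \<open>\<lambda>g. g \<ii>\<close>.\<close>

definition cluster_A :: "('i::finite, 'a::field, 'x::field) seed set \<Rightarrow> (('i, 'a, 'x) seed \<Rightarrow> 'i \<Rightarrow> real) set" where
  "cluster_A s = {g \<in> s \<rightarrow>\<^sub>E {x. \<forall>j. 0 < x j}.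
     (\<forall>\<ii>\<in>s. \<forall>k. g (mutate k \<ii>) = mut_A k (exmat \<ii>) (g \<ii>)) \<and>
     (\<forall>\<ii>\<in>s. \<forall>\<sigma>. bij \<sigma> \<and> relabel \<sigma> \<ii> \<in> s \<longrightarrow> g (relabel \<sigma> \<ii>) = g \<ii> \<circ> \<sigma>)}"

definition cluster_X :: "('i::finite, 'a::field, 'x::field) seed set \<Rightarrow> (('i, 'a, 'x) seed \<Rightarrow> 'i \<Rightarrow> real) set" where
  "cluster_X s = {g \<in> s \<rightarrow>\<^sub>E {x. \<forall>j. 0 < x j}.
     (\<forall>\<ii>\<in>s. \<forall>k. g (mutate k \<ii>) = mut_X k (exmat \<ii>) (g \<ii>)) \<and>
     (\<forall>\<ii>\<in>s. \<forall>\<sigma>. bij \<sigma> \<and> relabel \<sigma> \<ii> \<in> s \<longrightarrow> g (relabel \<sigma> \<ii>) = g \<ii> \<circ> \<sigma>)}"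

definition ensemble_map ::
    "('i::finite, 'a, 'x) seed set \<Rightarrow> (('i, 'a, 'x) seed \<Rightarrow> 'i \<Rightarrow> real) \<Rightarrow> ('i, 'a, 'x) seed \<Rightarrow> 'i \<Rightarrow> real" where
  "ensemble_map s g = (\<lambda>\<ii>\<in>s. \<lambda>k. \<Prod>j\<in>UNIV. g \<ii> j powi exmat \<ii> k j)"


section \<open>The cluster modular group\<close>

definition cluster_modular_group ::
    "('i::finite, 'a::field, 'x::field) seed set \<Rightarrow> (('i, 'a, 'x) seed \<Rightarrow> ('i, 'a, 'x) seed) monoid" where
  "cluster_modular_group s = (BijGroup s)\<lparr>carrier := {\<phi> \<in> Bij s.
     (\<forall>\<ii>\<in>s. exmat (\<phi> \<ii>) = exmat \<ii>) \<and>
     (\<forall>\<ii>\<in>s. \<forall>k. \<phi> (mutate k \<ii>) = mutate k (\<phi> \<ii>)) \<and>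
     (\<forall>\<ii>\<in>s. \<forall>\<sigma>. bij \<sigma> \<and> relabel \<sigma> \<ii> \<in> s \<longrightarrow> \<phi> (relabel \<sigma> \<ii>) = relabel \<sigma> (\<phi> \<ii>))}\<rparr>"

text \<open>The action on points is given by the same formula on both cluster manifolds.\<close>

definition modular_action ::
    "('i, 'a, 'x) seed set \<Rightarrow> (('i, 'a, 'x) seed \<Rightarrow> ('i, 'a, 'x) seed) \<Rightarrow>
     (('i, 'a, 'x) seed \<Rightarrow> 'i \<Rightarrow> real) \<Rightarrow> ('i, 'a, 'x) seed \<Rightarrow> 'i \<Rightarrow> real" where
  "modular_action s \<phi> g = (\<lambda>\<ii>\<in>s. g (inv_into s \<phi> \<ii>))"


section \<open>Filling sets\<close>

definition Supp :: "('i::finite, 'a::field, 'x) seed \<Rightarrow> 'a \<Rightarrow> (real^'i) set" where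
  "Supp \<ii> F = (\<lambda>\<alpha>. \<chi> j. real_of_int (\<alpha> j)) ` Poly_Mapping.keys (laurent_expr \<ii> F)"

definition Slope :: "('i::finite, 'a::field, 'x) seed \<Rightarrow> 'a \<Rightarrow> (real^'i) set" where
  "Slope \<ii> F = span {\<alpha> - \<beta> | \<alpha> \<beta>. \<alpha> \<in> Supp \<ii> F \<and> \<beta> \<in> Supp \<ii> F}"

definition ker_exmat :: "('i::finite \<Rightarrow> 'i \<Rightarrow> int) \<Rightarrow> (real^'i) set" where
  "ker_exmat \<epsilon> = {\<beta>. \<forall>k. (\<Sum>j\<in>UNIV. real_of_int (\<epsilon> k j) * \<beta> $ j) = 0}"

definition filling_set :: "('i::finite, 'a::field, 'x) seed set \<Rightarrow> 'a set \<Rightarrow> bool" where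
  "filling_set s \<Lambda> \<longleftrightarrow> finite \<Lambda> \<and> \<Lambda> \<subseteq> upper_cluster_algebra_pos s \<and>
     (\<exists>\<ii>\<in>s.
        (\<exists>S \<subseteq> (\<Union>F\<in>\<Lambda>. Supp \<ii> F).
           aff_dim (convex hull S) = int CARD('i) \<and> 0 \<in> interior (convex hull S)) \<and>
        (\<forall>F\<in>\<Lambda>. Slope \<ii> F \<subseteq> (ker_exmat (exmat \<ii>))\<^sup>\<bottom>) \<and>
        span (\<Union>F\<in>\<Lambda>. Slope \<ii> F) = (ker_exmat (exmat \<ii>))\<^sup>\<bottom>)"

end

theory Submission
  imports Defs "HOL-Library.Function_Algebras"
begin

text \<open>
  The fixed point is the minimum of an invariant function. For \<open>F\<close> in \<open>\<Lambda>\<close> and a point \<open>g\<close> of the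
  manifold, the value of the Laurent expression of \<open>F\<close> at the coordinates of \<open>g\<close> is the same in all
  charts (\<open>laurent_eval_chart_independent\<close>), so \<open>F\<close> is a function on the manifold. Average it: let
  \<open>\<Phi>(g)\<close> be the sum of \<open>F(\<gamma> g)\<close> over \<open>F \<in> \<Lambda>\<close> and \<open>\<gamma> \<in> G\<close>. This function is \<open>G\<close>-invariant. Moreover
  \<open>\<gamma>\<close> permutes the charts, and \<open>F\<close> has positive coefficients in every one of them; hence in the
  logarithmic coordinates of any single chart \<open>\<Phi>\<close> is a sum of exponentials of linear forms with
  positive coefficients. In the chart in which \<open>\<Lambda>\<close> fills, the exponents (already those of
  \<open>\<gamma> = id\<close>) have 0 in the interior of their convex hull. Then \<open>\<Phi>\<close> is proper and strictly convex
  there, so it has exactly one minimum (\<open>exponential_sum_has_strict_minimum\<close>). Since \<open>G\<close> permutes the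
  points at which \<open>\<Phi>\<close> is minimal, it fixes this one. Only the description of \<open>\<Phi>\<close> in one chart enters:
  the elements of \<open>G\<close> need not act convexly.

  Invariance of exchange matrices makes the ensemble map equivariant, so the image of the fixed
  point is fixed too; that the image lies in the manifold of the \<open>X\<close>-coordinates is the identity
  \<open>ensemble_mutation\<close>.

  For this argument the manifold must have its expected shape: every chart has to be a bijection onto the
  positive orthant, although a point is defined as a compatible family of coordinates in the charts of all,
  possibly infinitely many, seeds of the class. Two things have to be excluded: that a mutation leaves the set
  of seeds, and that different mutation paths to the same seed give different coordinates. Both are settled by
  one principle. An element of the field that is a quotient of polynomials in a tuple \<open>A\<close> of free
  generators, with a denominator that is positive on the positive orthant, defines a function on the orthant,
  and since \<open>A\<close> satisfies no polynomial relation, this function depends on the element only and not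
  on the way in which it was computed (\<open>represents_unique\<close>). Conversely, a polynomial that vanishes
  on the orthant is zero, so relations between elements can be tested on the functions; this shows that mutation
  preserves free generators, because on the orthant it is a bijection (\<open>free_generators_transfer\<close>).
\<close>

abbreviation orthant :: "('i \<Rightarrow> real) set" where
  "orthant \<equiv> {x. \<forall>j. 0 < x j}"

section \<open>Evaluation of polynomials\<close>

text \<open>With exponent vectors added pointwise, finitely supported functions on them form the ring of
  polynomials, and evaluation is shown to be a ring homomorphism.\<close>

lemma poly_eval_superset:
  assumes "finite K" "Poly_Mapping.keys P \<subseteq> K"
  shows "poly_eval P A = (\<Sum>m\<in>K. of_rat (Poly_Mapping.lookup P m) * (\<Prod>j\<in>UNIV. A j ^ m j))"
  unfolding poly_eval_def
  by (rule sum.mono_neutral_left) (use assms in \<open>auto simp: in_keys_iff\<close>)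

lemma poly_eval_zero [simp]: "poly_eval 0 A = 0"
  by (simp add: poly_eval_def)

lemma poly_eval_add: "poly_eval (P + Q) A = poly_eval P A + poly_eval Q A"
proof -
  let ?K = "Poly_Mapping.keys P \<union> Poly_Mapping.keys Q"
  show ?thesis
    using Poly_Mapping.keys_add[of P Q]
    by (simp add: poly_eval_superset[of ?K] lookup_add of_rat_add distrib_right sum.distrib)
qed

lemma poly_eval_diff: "poly_eval (P - Q) A = poly_eval P A - poly_eval Q A"
  using poly_eval_add[of "P - Q" Q A] by simp

lemma poly_eval_single: "poly_eval (Poly_Mapping.single m c) A = of_rat c * (\<Prod>j\<in>UNIV. A j ^ m j)"
  by (subst poly_eval_superset[of "{m}"]) auto

lemma poly_eval_sum: "poly_eval (\<Sum>t\<in>T. P t) A = (\<Sum>t\<in>T. poly_eval (P t) A)"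
  by (induction T rule: infinite_finite_induct) (auto simp: poly_eval_add)

lemma poly_mapping_eq_sum_single:
  "P = (\<Sum>m\<in>Poly_Mapping.keys P. Poly_Mapping.single m (Poly_Mapping.lookup P m))"
proof (rule poly_mapping_eqI)
  fix n
  have "Poly_Mapping.lookup (\<Sum>m\<in>T. Poly_Mapping.single m (Poly_Mapping.lookup P m)) n =
      (\<Sum>m\<in>T. Poly_Mapping.lookup (Poly_Mapping.single m (Poly_Mapping.lookup P m)) n)" for T
    by (induction T rule: infinite_finite_induct) (auto simp: lookup_add)
  then show "Poly_Mapping.lookup P n = Poly_Mapping.lookup
      (\<Sum>m\<in>Poly_Mapping.keys P. Poly_Mapping.single m (Poly_Mapping.lookup P m)) n"
    by (simp add: lookup_single when_def in_keys_iff)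
qed

lemma poly_eval_mult: "poly_eval (P * Q) A = poly_eval P A * poly_eval Q A"
proof -
  let ?s = "\<lambda>P m. Poly_Mapping.single m (Poly_Mapping.lookup P m)"
  have "P * Q = (\<Sum>m\<in>Poly_Mapping.keys P. ?s P m) * (\<Sum>n\<in>Poly_Mapping.keys Q. ?s Q n)"
    by (simp only: poly_mapping_eq_sum_single [symmetric])
  also have "\<dots> = (\<Sum>m\<in>Poly_Mapping.keys P. \<Sum>n\<in>Poly_Mapping.keys Q. ?s P m * ?s Q n)"
    by (rule sum_product)
  finally have "poly_eval (P * Q) A =
      (\<Sum>m\<in>Poly_Mapping.keys P. \<Sum>n\<in>Poly_Mapping.keys Q. poly_eval (?s P m) A * poly_eval (?s Q n) A)"
    by (simp add: poly_eval_sum mult_single poly_eval_single of_rat_mult power_add prod.distrib mult_ac)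
  also have "\<dots> = poly_eval P A * poly_eval Q A"
    unfolding poly_eval_single by (simp add: poly_eval_def sum_product)
  finally show ?thesis .
qed

lemma poly_eval_const: "poly_eval (Poly_Mapping.single 0 c) A = of_rat c"
  by (simp add: poly_eval_single)

lemma poly_eval_one [simp]: "poly_eval 1 A = 1"
  using poly_eval_const[of 1 A] by simp

lemma poly_eval_var:
  "poly_eval (Poly_Mapping.single (\<lambda>i. if i = j then 1 else 0) 1) A = A j"
proof -
  have "A i ^ (if i = j then 1 else 0) = (if i = j then A j else 1)" for i by simp
  then show ?thesis by (simp add: poly_eval_single)
qed

section \<open>Elements of the field as functions on the positive orthant\<close>

text \<open>The element \<open>a\<close> is a quotient \<open>P/Q\<close> of polynomials in the tuple \<open>A\<close>, and \<open>f\<close> is the same quotient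
  on the orthant. Positivity of \<open>Q\<close> there serves twice: the real quotient is defined everywhere, and
  \<open>Q\<close> is not the zero polynomial, so that the quotient in the field is defined as well. Both
  quotients are written without division.\<close>

definition represents ::
    "('i::finite \<Rightarrow> 'a::field_char_0) \<Rightarrow> 'a \<Rightarrow> (('i \<Rightarrow> real) \<Rightarrow> real) \<Rightarrow> bool" where
  "represents A a f \<longleftrightarrow> (\<exists>P Q. (\<forall>x\<in>orthant. 0 < poly_eval Q x \<and> f x * poly_eval Q x = poly_eval P x) \<and>
     a * poly_eval Q A = poly_eval P A)"

lemma poly_eval_nonzero:
  assumes "free_generators A" "\<forall>x\<in>orthant. 0 < (poly_eval Q x :: real)"
  shows "poly_eval Q A \<noteq> 0"
proof
  assume "poly_eval Q A = 0"
  then have "Q = 0" using assms(1) unfolding free_generators_def by blast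
  moreover have "(\<lambda>_. 1) \<in> orthant" by simp
  ultimately show False using assms(2) by (metis less_irrefl poly_eval_zero)
qed

text \<open>Two fractions for the same element give, after clearing denominators, a polynomial relation
  between the free generators. It must be trivial, hence it holds for real numbers too.\<close>

lemma represents_unique:
  assumes "free_generators A" "represents A a f" "represents A a g" "x \<in> orthant"
  shows "f x = g x"
proof -
  obtain P Q where PQ: "\<forall>x\<in>orthant. 0 < poly_eval Q x \<and> f x * poly_eval Q x = poly_eval P x"
     "a * poly_eval Q A = poly_eval P A" using assms(2) unfolding represents_def by blast
  obtain P' Q' where PQ': "\<forall>x\<in>orthant. 0 < poly_eval Q' x \<and> g x * poly_eval Q' x = poly_eval P' x"
     "a * poly_eval Q' A = poly_eval P' A" using assms(3) unfolding represents_def by blast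
  have "poly_eval (P * Q' - P' * Q) A = 0"
    by (simp add: poly_eval_diff poly_eval_mult PQ(2)[symmetric] PQ'(2)[symmetric])
  then have 0: "P * Q' - P' * Q = 0" using assms(1) unfolding free_generators_def by blast
  have "poly_eval P x * poly_eval Q' x = poly_eval P' x * poly_eval Q x"
    using arg_cong[OF 0, of "\<lambda>R. poly_eval R x"] by (simp add: poly_eval_diff poly_eval_mult)
  moreover have "poly_eval P x = f x * poly_eval Q x" "poly_eval P' x = g x * poly_eval Q' x"
    "poly_eval Q x > 0" "poly_eval Q' x > 0" using PQ PQ' assms(4) by auto
  ultimately show ?thesis by simp
qed

lemma represents_var: "represents A (A j) (\<lambda>x. x j)"
  unfolding represents_def
  by (rule exI[of _ "Poly_Mapping.single (\<lambda>i. if i = j then 1 else 0) 1"],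
      rule exI[of _ "Poly_Mapping.single 0 1"]) (simp only: poly_eval_var poly_eval_const, simp)

lemma represents_of_rat: "represents A (of_rat c) (\<lambda>x. of_rat c)"
  unfolding represents_def
  by (rule exI[of _ "Poly_Mapping.single 0 c"],
      rule exI[of _ "Poly_Mapping.single 0 1"]) (simp add: poly_eval_const)

lemma represents_of_int: "represents A (of_int c) (\<lambda>x. of_int c)"
  using represents_of_rat[of A "of_int c"] by simp

lemma represents_0: "represents A 0 (\<lambda>x. 0)" and represents_1: "represents A 1 (\<lambda>x. 1)"
  using represents_of_int[of A 0] represents_of_int[of A 1] by simp_all

lemma represents_add:
  assumes "represents A a f" "represents A b g"
  shows "represents A (a + b) (\<lambda>x. f x + g x)"
proof -
  obtain P Q where PQ: "\<forall>x\<in>orthant. 0 < poly_eval Q x \<and> f x * poly_eval Q x = poly_eval P x"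
     "a * poly_eval Q A = poly_eval P A" using assms(1) unfolding represents_def by blast
  obtain P' Q' where PQ': "\<forall>x\<in>orthant. 0 < poly_eval Q' x \<and> g x * poly_eval Q' x = poly_eval P' x"
     "b * poly_eval Q' A = poly_eval P' A" using assms(2) unfolding represents_def by blast
  show ?thesis
    unfolding represents_def
  proof (intro exI conjI ballI)
    show "(a + b) * poly_eval (Q * Q') A = poly_eval (P * Q' + P' * Q) A"
      by (simp add: poly_eval_add poly_eval_mult PQ(2)[symmetric] PQ'(2)[symmetric] algebra_simps)
    fix x :: "'a \<Rightarrow> real" assume x: "x \<in> orthant"
    show "0 < poly_eval (Q * Q') x" using PQ PQ' x by (simp add: poly_eval_mult)
    have "poly_eval P x = f x * poly_eval Q x" "poly_eval P' x = g x * poly_eval Q' x"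
      using PQ PQ' x by auto
    then show "(f x + g x) * poly_eval (Q * Q') x = poly_eval (P * Q' + P' * Q) x"
      by (simp add: poly_eval_add poly_eval_mult algebra_simps)
  qed
qed

lemma represents_mult:
  assumes "represents A a f" "represents A b g"
  shows "represents A (a * b) (\<lambda>x. f x * g x)"
proof -
  obtain P Q where PQ: "\<forall>x\<in>orthant. 0 < poly_eval Q x \<and> f x * poly_eval Q x = poly_eval P x"
     "a * poly_eval Q A = poly_eval P A" using assms(1) unfolding represents_def by blast
  obtain P' Q' where PQ': "\<forall>x\<in>orthant. 0 < poly_eval Q' x \<and> g x * poly_eval Q' x = poly_eval P' x"
     "b * poly_eval Q' A = poly_eval P' A" using assms(2) unfolding represents_def by blast
  show ?thesis
    unfolding represents_def
  proof (intro exI conjI ballI)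
    show "(a * b) * poly_eval (Q * Q') A = poly_eval (P * P') A"
      by (simp add: poly_eval_mult PQ(2)[symmetric] PQ'(2)[symmetric] mult_ac)
    fix x :: "'a \<Rightarrow> real" assume x: "x \<in> orthant"
    show "0 < poly_eval (Q * Q') x" using PQ PQ' x by (simp add: poly_eval_mult)
    have "poly_eval P x = f x * poly_eval Q x" "poly_eval P' x = g x * poly_eval Q' x"
      using PQ PQ' x by auto
    then show "(f x * g x) * poly_eval (Q * Q') x = poly_eval (P * P') x"
      by (simp add: poly_eval_mult mult_ac)
  qed
qed

text \<open>Inversion exchanges numerator and denominator; positivity of the function keeps the new
  denominator positive. This is why the exchange relations, which contain no subtraction, stay
  within the represented elements.\<close>

lemma represents_inverse:
  assumes A: "free_generators A" and a: "represents A a f" and pos: "\<forall>x\<in>orthant. 0 < f x"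
  shows "represents A (inverse a) (\<lambda>x. inverse (f x))"
proof -
  obtain P Q where PQ: "\<forall>x\<in>orthant. 0 < poly_eval Q x \<and> f x * poly_eval Q x = poly_eval P x"
     "a * poly_eval Q A = poly_eval P A" using a unfolding represents_def by blast
  have P: "\<forall>x\<in>orthant. 0 < (poly_eval P x :: real)"
    using PQ(1) pos by (metis mult_pos_pos)
  have "poly_eval P A \<noteq> 0" by (rule poly_eval_nonzero[OF A P])
  show ?thesis
    unfolding represents_def
  proof (intro exI conjI ballI)
    show "inverse a * poly_eval P A = poly_eval Q A"
      using PQ(2)[symmetric] \<open>poly_eval P A \<noteq> 0\<close> by simp
    fix x :: "'a \<Rightarrow> real" assume x: "x \<in> orthant"
    show "0 < (poly_eval P x :: real)" using P x by blast
    have "poly_eval P x = f x * poly_eval Q x" "f x > 0" using PQ pos x by auto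
    then show "inverse (f x) * poly_eval P x = poly_eval Q x" by simp
  qed
qed

lemma represents_sum:
  "(\<And>t. t \<in> T \<Longrightarrow> represents A (a t) (f t)) \<Longrightarrow> represents A (\<Sum>t\<in>T. a t) (\<lambda>x. \<Sum>t\<in>T. f t x)"
  by (induction T rule: infinite_finite_induct) (auto simp: represents_0 represents_add)

lemma represents_prod:
  "(\<And>t. t \<in> T \<Longrightarrow> represents A (a t) (f t)) \<Longrightarrow> represents A (\<Prod>t\<in>T. a t) (\<lambda>x. \<Prod>t\<in>T. f t x)"
  by (induction T rule: infinite_finite_induct) (auto simp: represents_1 represents_mult)

lemma represents_power: "represents A a f \<Longrightarrow> represents A (a ^ n) (\<lambda>x. f x ^ n)"
  by (induction n) (auto simp: represents_1 represents_mult)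

lemma represents_power_int:
  assumes "free_generators A" "represents A a f" "\<forall>x\<in>orthant. 0 < f x"
  shows "represents A (a powi n) (\<lambda>x. f x powi n)"
proof (cases "n \<ge> 0")
  case True
  then show ?thesis using represents_power[OF assms(2)] by (simp add: power_int_def)
next
  case False
  then show ?thesis
    using represents_power[OF represents_inverse[OF assms]] by (simp add: power_int_def)
qed

lemma represents_nonzero:
  assumes "free_generators A" "represents A a f" "\<forall>x\<in>orthant. 0 < f x"
  shows "a \<noteq> 0"
proof
  assume "a = 0"
  then have "represents A a (\<lambda>x. 0)" by (simp add: represents_0)
  then have "f (\<lambda>_. 1) = 0"
    by (rule represents_unique[OF assms(1,2)]) simp
  moreover have "0 < f (\<lambda>_. 1)" using assms(3) by simp
  ultimately show False by simp
qed

lemma represents_poly_eval: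
  assumes "\<And>j. represents A (B j) (\<lambda>x. f x j)"
  shows "represents A (poly_eval P B) (\<lambda>x. poly_eval P (f x))"
  unfolding poly_eval_def
  by (intro represents_sum represents_mult represents_of_rat represents_prod represents_power assms)

lemma represents_laurent_eval:
  assumes "free_generators A" "\<And>j. represents A (B j) (\<lambda>x. f x j)" "\<forall>x\<in>orthant. f x \<in> orthant"
  shows "represents A (laurent_eval c B) (\<lambda>x. laurent_eval c (f x))"
  unfolding laurent_eval_def
  by (intro represents_sum represents_mult represents_of_int represents_prod represents_power_int)
     (use assms in auto)

section \<open>Linear independence of monomials\<close>

text \<open>This is Dedekind's argument for the independence of characters: Laurent monomials are
  multiplicative functions on the orthant. Translating a linear relation by \<open>y\<close> and subtracting the
  relation scaled by the value of one monomial \<open>\<beta>\<close> at \<open>y\<close> gives a shorter relation.\<close>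

lemma laurent_monomials_independent:
  fixes c :: "('i::finite \<Rightarrow> int) \<Rightarrow> real"
  assumes "finite S" and "\<And>x. x \<in> orthant \<Longrightarrow> (\<Sum>\<alpha>\<in>S. c \<alpha> * (\<Prod>j\<in>UNIV. x j powi \<alpha> j)) = 0"
    and "\<alpha> \<in> S"
  shows "c \<alpha> = 0"
  using assms
proof (induction S arbitrary: c \<alpha> rule: finite_induct)
  case (insert \<beta> S)
  let ?m = "\<lambda>\<alpha> x. \<Prod>j\<in>UNIV. (x j :: real) powi (\<alpha> j :: int)"
  have S: "c \<alpha> = 0" if \<alpha>: "\<alpha> \<in> S" for \<alpha>
  proof -
    obtain l where l: "\<alpha> l \<noteq> \<beta> l" using \<alpha> insert.hyps by (metis ext)
    \<comment> \<open>a point at which \<open>\<alpha>\<close> and \<open>\<beta>\<close> differ, so that \<open>\<alpha>\<close> keeps a nonzero factor in the shorter relation\<close>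
    define y :: "'i \<Rightarrow> real" where "y = (\<lambda>j. if j = l then 2 else 1)"
    have my: "?m \<gamma> y = 2 powi \<gamma> l" for \<gamma> :: "'i \<Rightarrow> int"
    proof -
      have "y j powi \<gamma> j = (if j = l then 2 powi \<gamma> l else 1)" for j by (simp add: y_def)
      then show ?thesis by simp
    qed
    have "c \<alpha> * (?m \<alpha> y - ?m \<beta> y) = 0"
    proof (rule insert.IH[of "\<lambda>\<alpha>. c \<alpha> * (?m \<alpha> y - ?m \<beta> y)", OF _ \<alpha>])
      fix x :: "'i \<Rightarrow> real" assume x: "x \<in> orthant"
      have mult: "?m \<gamma> (\<lambda>j. x j * y j) = ?m \<gamma> x * ?m \<gamma> y" for \<gamma> :: "'i \<Rightarrow> int"
        by (simp add: power_int_mult_distrib prod.distrib)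
      have xy: "(\<lambda>j. x j * y j) \<in> orthant" using x by (auto simp: y_def)
      have "(\<Sum>\<alpha>\<in>insert \<beta> S. c \<alpha> * ?m \<alpha> (\<lambda>j. x j * y j)) - ?m \<beta> y * (\<Sum>\<alpha>\<in>insert \<beta> S. c \<alpha> * ?m \<alpha> x) = 0"
        using insert.prems(1)[OF x] insert.prems(1)[OF xy] by simp
      then show "(\<Sum>\<alpha>\<in>S. c \<alpha> * (?m \<alpha> y - ?m \<beta> y) * ?m \<alpha> x) = 0"
        using insert.hyps unfolding mult
        by (simp add: algebra_simps sum_distrib_left sum_subtractf)
    qed
    moreover have "(2::real) powi \<alpha> l \<noteq> 2 powi \<beta> l"
      using l power_int_strict_increasing[of "\<alpha> l" "\<beta> l" "2::real"]
        power_int_strict_increasing[of "\<beta> l" "\<alpha> l" "2::real"] by linarith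
    ultimately show ?thesis unfolding my by simp
  qed
  have "(\<Sum>\<alpha>\<in>insert \<beta> S. c \<alpha> * ?m \<alpha> (\<lambda>_. 1)) = 0" by (rule insert.prems(1)) simp
  then have "c \<beta> = 0" using insert.hyps S by simp
  then show ?case using S insert.prems(2) by blast
qed simp

lemma poly_eq_0_if_vanishes_on_orthant:
  fixes P :: "('i::finite \<Rightarrow> nat) \<Rightarrow>\<^sub>0 rat"
  assumes "\<And>x. x \<in> orthant \<Longrightarrow> (poly_eval P x :: real) = 0"
  shows "P = 0"
proof -
  let ?K = "Poly_Mapping.keys P" and ?i = "\<lambda>m j. int (m j)"
  have inj: "inj_on ?i ?K" by (auto simp: inj_on_def fun_eq_iff)
  have "of_rat (Poly_Mapping.lookup P m) = (0 :: real)" if m: "m \<in> ?K" for m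
  proof -
    let ?c = "\<lambda>\<alpha>. of_rat (Poly_Mapping.lookup P (\<lambda>j. nat (\<alpha> j))) :: real"
    have "?c (?i m) = 0"
    proof (rule laurent_monomials_independent[of "?i ` ?K"])
      fix x :: "'i \<Rightarrow> real" assume "x \<in> orthant"
      then show "(\<Sum>\<alpha>\<in>?i ` ?K. ?c \<alpha> * (\<Prod>j\<in>UNIV. x j powi \<alpha> j)) = 0"
        using assms[of x] by (simp add: sum.reindex[OF inj] poly_eval_def)
    qed (use m in auto)
    then show ?thesis by simp
  qed
  then show ?thesis by (intro poly_mapping_eqI) (auto simp: in_keys_iff)
qed

lemma laurent_poly_eq_if_equal_on_orthant:
  fixes c c' :: "('i::finite \<Rightarrow> int) \<Rightarrow>\<^sub>0 int"
  assumes "\<And>x. x \<in> orthant \<Longrightarrow> laurent_eval c x = (laurent_eval c' x :: real)"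
  shows "c = c'"
proof -
  let ?K = "Poly_Mapping.keys c \<union> Poly_Mapping.keys c'"
  have ev: "laurent_eval b x = (\<Sum>\<alpha>\<in>?K. of_int (Poly_Mapping.lookup b \<alpha>) * (\<Prod>j\<in>UNIV. x j powi \<alpha> j))"
    if "Poly_Mapping.keys b \<subseteq> ?K" for b and x :: "'i \<Rightarrow> real"
    unfolding laurent_eval_def
    by (rule sum.mono_neutral_left) (use that in \<open>auto simp: in_keys_iff\<close>)
  have "real_of_int (Poly_Mapping.lookup c \<alpha>) - of_int (Poly_Mapping.lookup c' \<alpha>) = 0"
    if \<alpha>: "\<alpha> \<in> ?K" for \<alpha>
  proof (rule laurent_monomials_independent
      [of ?K "\<lambda>\<alpha>. real_of_int (Poly_Mapping.lookup c \<alpha>) - of_int (Poly_Mapping.lookup c' \<alpha>)"])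
    fix x :: "'i \<Rightarrow> real" assume "x \<in> orthant"
    then show "(\<Sum>\<alpha>\<in>?K. (real_of_int (Poly_Mapping.lookup c \<alpha>) - of_int (Poly_Mapping.lookup c' \<alpha>)) *
        (\<Prod>j\<in>UNIV. x j powi \<alpha> j)) = 0"
      using assms[of x] by (simp add: ev left_diff_distrib sum_subtractf)
  qed (use \<alpha> in auto)
  then show ?thesis by (intro poly_mapping_eqI) (metis Un_iff eq_iff_diff_eq_0 in_keys_iff of_int_eq_iff)
qed

text \<open>Uniqueness of Laurent expressions in free generators, read off from the functions on the
  orthant.\<close>

lemma laurent_eval_inj:
  assumes "free_generators A" "laurent_eval c A = laurent_eval c' A"
  shows "c = c'"
proof (rule laurent_poly_eq_if_equal_on_orthant)
  fix x :: "'a \<Rightarrow> real" assume "x \<in> orthant"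
  moreover have "represents A (laurent_eval c A) (laurent_eval c)" for c
    by (rule represents_laurent_eval[of A A "\<lambda>x. x"]) (auto simp: assms represents_var)
  ultimately show "laurent_eval c x = laurent_eval c' x"
    using represents_unique[OF assms(1)] assms(2) by metis
qed

section \<open>Mutation preserves seeds\<close>

text \<open>A polynomial relation for \<open>B\<close> becomes, through the represented functions, a polynomial that
  vanishes on the image of \<open>f\<close>. As this image is the whole orthant, the polynomial is zero. The
  criterion replaces any computation of Jacobians or transcendence degrees.\<close>

lemma free_generators_transfer:
  assumes A: "free_generators A"
    and rep: "\<And>j. represents A (B j) (\<lambda>x. f x j)"
    and surj: "\<And>y. y \<in> orthant \<Longrightarrow> \<exists>x\<in>orthant. f x = y"
    and gen: "\<And>K j. is_subfield K \<Longrightarrow> range B \<subseteq> K \<Longrightarrow> A j \<in> K"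
  shows "free_generators B"
  unfolding free_generators_def
proof (intro conjI allI impI)
  fix P assume P: "poly_eval P B = 0"
  have "poly_eval P y = (0::real)" if y: "y \<in> orthant" for y
  proof -
    obtain x where x: "x \<in> orthant" "f x = y" using surj[OF y] by blast
    have "represents A 0 (\<lambda>x. poly_eval P (f x))"
      using represents_poly_eval[of A B f P, OF rep] P by simp
    then show ?thesis using represents_unique[OF A _ represents_0 x(1)] x(2) by metis
  qed
  then show "P = 0" by (rule poly_eq_0_if_vanishes_on_orthant)
next
  have "is_subfield hull range A \<subseteq> K" if "is_subfield K" "range B \<subseteq> K" for K
    by (rule hull_minimal) (use gen that in auto)
  then show "is_subfield hull range B = UNIV"
    using A unfolding free_generators_def hull_def[of is_subfield "range B"] by auto
qed

lemma subfield_prod: "is_subfield K \<Longrightarrow> (\<And>t. t \<in> T \<Longrightarrow> a t \<in> K) \<Longrightarrow> (\<Prod>t\<in>T. a t) \<in> K"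
  by (induction T rule: infinite_finite_induct) (auto simp: is_subfield_def)

lemma subfield_power_int:
  assumes "is_subfield K" "a \<in> K"
  shows "a powi n \<in> K"
proof -
  have "b ^ m \<in> K" if "b \<in> K" for b and m :: nat
    using assms(1) that by (induction m) (auto simp: is_subfield_def)
  then show ?thesis using assms by (auto simp: power_int_def is_subfield_def)
qed

lemma subfield_mut_A:
  assumes K: "is_subfield K" and A: "\<And>j. A j \<in> K"
  shows "mut_A k \<epsilon> A i \<in> K"
proof -
  have "(\<Prod>j\<in>UNIV. A j powi e j) \<in> K" for e
    by (intro subfield_prod subfield_power_int K A)
  then show ?thesis using K A by (simp add: mut_A_def is_subfield_def)
qed

lemma subfield_mut_X:
  assumes K: "is_subfield K" and X: "\<And>j. X j \<in> K"
  shows "mut_X k \<epsilon> X i \<in> K"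
proof -
  have "1 + X k powi e \<in> K" for e
    using K subfield_power_int[OF K X] by (simp add: is_subfield_def)
  then have "(1 + X k powi e) powi e' \<in> K" for e e'
    by (intro subfield_power_int K)
  then show ?thesis using K X by (simp add: mut_X_def is_subfield_def)
qed

lemma mut_mat_involution: "mut_mat k (mut_mat k \<epsilon>) = \<epsilon>"
  by (auto simp: mut_mat_def fun_eq_iff)

text \<open>The exchange polynomial of direction \<open>k\<close> does not contain the \<open>k\<close>-th variable, as the diagonal
  of the exchange matrix is zero. Therefore it is unchanged by the mutation, which makes mutation an
  involution.\<close>

lemma exchange_prod_cong:
  fixes e :: "'i::finite \<Rightarrow> int"
  assumes "e k = 0" "\<And>j. j \<noteq> k \<Longrightarrow> A j = B j"
  shows "(\<Prod>j\<in>UNIV. A j powi e j) = (\<Prod>j\<in>UNIV. B j powi e j)"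
proof (rule prod.cong)
  fix j show "A j powi e j = B j powi e j" using assms by (cases "j = k") auto
qed simp

lemma mut_A_involution:
  fixes A :: "'i::finite \<Rightarrow> 'a::field"
  assumes "\<epsilon> k k = 0"
    and "(\<Prod>j\<in>UNIV. A j powi pos_part (\<epsilon> k j)) + (\<Prod>j\<in>UNIV. A j powi pos_part (- \<epsilon> k j)) \<noteq> 0"
  shows "mut_A k (mut_mat k \<epsilon>) (mut_A k \<epsilon> A) = A"
proof
  fix i
  let ?A' = "mut_A k \<epsilon> A"
  have e: "mut_mat k \<epsilon> k j = - \<epsilon> k j" for j by (simp add: mut_mat_def)
  have p: "(\<Prod>j\<in>UNIV. ?A' j powi pos_part (\<epsilon> k j)) = (\<Prod>j\<in>UNIV. A j powi pos_part (\<epsilon> k j))"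
    "(\<Prod>j\<in>UNIV. ?A' j powi pos_part (- \<epsilon> k j)) = (\<Prod>j\<in>UNIV. A j powi pos_part (- \<epsilon> k j))"
    by (rule exchange_prod_cong[of _ k]; simp add: mut_A_def pos_part_def assms)+
  show "mut_A k (mut_mat k \<epsilon>) ?A' i = A i"
  proof (cases "i = k")
    case True
    have "mut_A k (mut_mat k \<epsilon>) ?A' k = inverse (?A' k) *
       ((\<Prod>j\<in>UNIV. A j powi pos_part (- \<epsilon> k j)) + (\<Prod>j\<in>UNIV. A j powi pos_part (\<epsilon> k j)))"
      unfolding mut_A_def[of k "mut_mat k \<epsilon>"] by (simp add: e p)
    also have "\<dots> = A k"
      using assms(2) by (simp add: mut_A_def add.commute)
    finally show ?thesis using True by simp
  qed (simp add: mut_A_def)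
qed

lemma mut_X_involution:
  fixes X :: "'i \<Rightarrow> 'x::field"
  assumes "\<And>j. 1 + X k powi (- sgn (\<epsilon> j k)) \<noteq> 0"
  shows "mut_X k (mut_mat k \<epsilon>) (mut_X k \<epsilon> X) = X"
proof
  fix i
  show "mut_X k (mut_mat k \<epsilon>) (mut_X k \<epsilon> X) i = X i"
    using assms[of i] by (auto simp: mut_X_def mut_mat_def power_int_minus sgn_if field_simps)
qed

lemma mut_A_orthant: "x \<in> orthant \<Longrightarrow> mut_A k \<epsilon> x \<in> orthant"
  by (auto simp: mut_A_def intro!: mult_pos_pos add_pos_pos prod_pos)

lemma mut_X_orthant: "x \<in> orthant \<Longrightarrow> mut_X k \<epsilon> x \<in> orthant"
  by (auto simp: mut_X_def intro!: mult_pos_pos add_pos_pos zero_less_power_int)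

lemma mut_A_involution_orthant:
  fixes x :: "'i::finite \<Rightarrow> real"
  assumes "\<epsilon> k k = 0" "x \<in> orthant"
  shows "mut_A k (mut_mat k \<epsilon>) (mut_A k \<epsilon> x) = x"
proof (rule mut_A_involution)
  have "0 < (\<Prod>j\<in>UNIV. x j powi e j)" for e :: "'i \<Rightarrow> int"
    using assms(2) by (intro prod_pos) auto
  then show "(\<Prod>j\<in>UNIV. x j powi pos_part (\<epsilon> k j)) + (\<Prod>j\<in>UNIV. x j powi pos_part (- \<epsilon> k j)) \<noteq> 0"
    by (metis add_pos_pos less_irrefl)
qed fact

lemma mut_X_involution_orthant:
  fixes x :: "'i \<Rightarrow> real"
  assumes "x \<in> orthant"
  shows "mut_X k (mut_mat k \<epsilon>) (mut_X k \<epsilon> x) = x"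
proof (rule mut_X_involution)
  fix j
  have "0 < x k powi (- sgn (\<epsilon> j k))" using assms by auto
  then show "1 + x k powi (- sgn (\<epsilon> j k)) \<noteq> 0" by linarith
qed

lemma represents_exchange_monomial:
  assumes "free_generators A" "\<And>j. represents A (B j) (\<lambda>x. f x j)" "\<forall>x\<in>orthant. f x \<in> orthant"
  shows "represents A (\<Prod>j\<in>UNIV. B j powi e j) (\<lambda>x. \<Prod>j\<in>UNIV. f x j powi e j)"
  by (intro represents_prod represents_power_int) (use assms in auto)

lemma exchange_polynomial_nonzero:
  assumes "free_generators A" "\<And>j. represents A (B j) (\<lambda>x. f x j)" "\<forall>x\<in>orthant. f x \<in> orthant"
  shows "(\<Prod>j\<in>UNIV. B j powi e j) + (\<Prod>j\<in>UNIV. B j powi e' j) \<noteq> 0"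
proof (rule represents_nonzero[OF assms(1) represents_add])
  show "\<forall>x\<in>orthant. 0 < (\<Prod>j\<in>UNIV. f x j powi e j) + (\<Prod>j\<in>UNIV. f x j powi e' j)"
    using assms(3) by (auto intro!: add_pos_pos prod_pos)
qed (rule represents_exchange_monomial[OF assms])+

lemma represents_mut_A:
  assumes "free_generators A" "\<And>j. represents A (B j) (\<lambda>x. f x j)" "\<forall>x\<in>orthant. f x \<in> orthant"
  shows "represents A (mut_A k \<epsilon> B i) (\<lambda>x. mut_A k \<epsilon> (f x) i)"
  using assms(3)
  by (auto simp: mut_A_def assms(2)
      intro!: represents_mult represents_inverse represents_add represents_exchange_monomial assms)

lemma represents_mut_X:
  assumes "free_generators X" "\<And>j. represents X (Y j) (\<lambda>x. f x j)" "\<forall>x\<in>orthant. f x \<in> orthant"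
  shows "represents X (mut_X k \<epsilon> Y i) (\<lambda>x. mut_X k \<epsilon> (f x) i)"
  using assms(3)
  by (auto simp: mut_X_def assms(2) intro!: represents_mult represents_inverse represents_power_int
      represents_add represents_1 assms add_pos_pos)

lemma mut_A_involution_free:
  assumes A: "free_generators A" and \<epsilon>: "\<epsilon> k k = 0"
  shows "mut_A k (mut_mat k \<epsilon>) (mut_A k \<epsilon> A) = A"
  by (rule mut_A_involution[where \<epsilon> = \<epsilon>, OF \<epsilon>], rule exchange_polynomial_nonzero[OF A, where f = "\<lambda>x. x"])
     (auto simp: represents_var)

lemma free_generators_mut_A:
  assumes A: "free_generators A" and \<epsilon>: "\<epsilon> k k = 0"
  shows "free_generators (mut_A k \<epsilon> A)"
proof (rule free_generators_transfer[OF A])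
  show "represents A (mut_A k \<epsilon> A j) (\<lambda>x. mut_A k \<epsilon> x j)" for j
    by (rule represents_mut_A[OF A]) (auto simp: represents_var)
next
  fix y :: "'a \<Rightarrow> real" assume y: "y \<in> orthant"
  have "mut_A k \<epsilon> (mut_A k (mut_mat k \<epsilon>) y) = y"
    using mut_A_involution_orthant[of "mut_mat k \<epsilon>" k y] y \<epsilon>
    by (simp add: mut_mat_involution) (simp add: mut_mat_def)
  then show "\<exists>x\<in>orthant. mut_A k \<epsilon> x = y" using mut_A_orthant[OF y] by blast
next
  fix K j assume K: "is_subfield K" "range (mut_A k \<epsilon> A) \<subseteq> K"
  have "mut_A k (mut_mat k \<epsilon>) (mut_A k \<epsilon> A) j \<in> K"
    by (rule subfield_mut_A[OF K(1)]) (use K(2) in auto)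
  moreover have "mut_A k (mut_mat k \<epsilon>) (mut_A k \<epsilon> A) = A"
    by (rule mut_A_involution_free[where \<epsilon> = \<epsilon>, OF A \<epsilon>])
  ultimately show "A j \<in> K" by simp
qed

lemma one_plus_power_int_nonzero:
  assumes "free_generators X"
  shows "1 + X k powi e \<noteq> 0"
  by (rule represents_nonzero[OF assms represents_add[OF represents_1 represents_power_int[OF assms represents_var]]])
     (auto intro!: add_pos_pos)

lemma free_generators_mut_X:
  assumes X: "free_generators X"
  shows "free_generators (mut_X k \<epsilon> X)"
proof (rule free_generators_transfer[OF X])
  show "represents X (mut_X k \<epsilon> X j) (\<lambda>x. mut_X k \<epsilon> x j)" for j
    by (rule represents_mut_X[OF X]) (auto simp: represents_var)
next
  fix y :: "'a \<Rightarrow> real" assume y: "y \<in> orthant"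
  have "mut_X k \<epsilon> (mut_X k (mut_mat k \<epsilon>) y) = y"
    using mut_X_involution_orthant[of y k "mut_mat k \<epsilon>"] y by (simp add: mut_mat_involution)
  then show "\<exists>x\<in>orthant. mut_X k \<epsilon> x = y" using mut_X_orthant[OF y] by blast
next
  fix K j assume K: "is_subfield K" "range (mut_X k \<epsilon> X) \<subseteq> K"
  have "mut_X k (mut_mat k \<epsilon>) (mut_X k \<epsilon> X) j \<in> K"
    by (rule subfield_mut_X[OF K(1)]) (use K(2) in auto)
  moreover have "mut_X k (mut_mat k \<epsilon>) (mut_X k \<epsilon> X) = X"
    by (rule mut_X_involution) (rule one_plus_power_int_nonzero[OF X])
  ultimately show "X j \<in> K" by simp
qed

lemma pos_part_mult: "pos_part x * int n = pos_part (x * int n)"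
  by (auto simp: pos_part_def max_def mult_le_0_iff not_le zero_less_mult_iff)

text \<open>Skew-symmetry after scaling turns \<open>[\<epsilon>\<^sub>i\<^sub>k]\<^sub>+[\<epsilon>\<^sub>k\<^sub>j]\<^sub>+ d\<^sub>j\<close> into \<open>[-\<epsilon>\<^sub>j\<^sub>k]\<^sub>+[-\<epsilon>\<^sub>k\<^sub>i]\<^sub>+ d\<^sub>i\<close>: move \<open>d\<close> across one
  factor, then across the other. So the two correction terms of the matrix mutation are exchanged.\<close>

lemma mut_mat_skew:
  assumes "\<And>i j. \<epsilon> i j * int (d j) = - (\<epsilon> j i * int (d i))"
  shows "mut_mat k \<epsilon> i j * int (d j) = - (mut_mat k \<epsilon> j i * int (d i))"
proof -
  have swap: "pos_part (s * \<epsilon> i j) * int (d j) = pos_part (- s * \<epsilon> j i) * int (d i)" for s i j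
    using assms[of i j] by (simp add: pos_part_mult mult.assoc)
  have *: "pos_part (s * \<epsilon> i k) * pos_part (s * \<epsilon> k j) * int (d j)
      = pos_part (- s * \<epsilon> j k) * pos_part (- s * \<epsilon> k i) * int (d i)" for s i j
    using swap[of s k j] swap[of s i k] by algebra
  show ?thesis
    using *[of 1 i j] *[of "-1" i j] assms[of i j] assms[of j i]
    by (auto simp: mut_mat_def algebra_simps)
qed

lemma exmat_diagonal:
  assumes "\<ii> \<in> seeds d" "0 < d k"
  shows "exmat \<ii> k k = 0"
proof -
  have "exmat \<ii> k k * int (d k) = - (exmat \<ii> k k * int (d k))"
    using assms(1) unfolding seeds_def by blast
  then show ?thesis using assms(2) by simp
qed

lemma mutate_in_seeds:
  assumes "\<ii> \<in> seeds d" "0 < d k"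
  shows "mutate k \<ii> \<in> seeds d"
proof -
  have skew: "exmat \<ii> i j * int (d j) = - (exmat \<ii> j i * int (d i))" for i j
    using assms(1) unfolding seeds_def by blast
  have "\<forall>i j. mut_mat k (exmat \<ii>) i j * int (d j) = - (mut_mat k (exmat \<ii>) j i * int (d i))"
    by (intro allI mut_mat_skew skew)
  moreover have "free_generators (Avar \<ii>)" "free_generators (Xvar \<ii>)"
    using assms(1) by (simp_all only: seeds_def mem_Collect_eq)
  then have "free_generators (mut_A k (exmat \<ii>) (Avar \<ii>))" "free_generators (mut_X k (exmat \<ii>) (Xvar \<ii>))"
    using free_generators_mut_A[where \<epsilon> = "exmat \<ii>", OF _ exmat_diagonal[OF assms]] free_generators_mut_X
    by blast+
  ultimately show ?thesis unfolding seeds_def mutate_def mem_Collect_eq seed.sel by (intro conjI)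
qed

lemma mutate_mutate:
  assumes "\<ii> \<in> seeds d" "0 < d k"
  shows "mutate k (mutate k \<ii>) = \<ii>"
proof -
  have A: "free_generators (Avar \<ii>)" and X: "free_generators (Xvar \<ii>)"
    using assms(1) by (simp_all only: seeds_def mem_Collect_eq)
  have "mut_A k (mut_mat k (exmat \<ii>)) (mut_A k (exmat \<ii>) (Avar \<ii>)) = Avar \<ii>"
    by (rule mut_A_involution_free[where \<epsilon> = "exmat \<ii>", OF A exmat_diagonal[OF assms]])
  moreover have "mut_X k (mut_mat k (exmat \<ii>)) (mut_X k (exmat \<ii>) (Xvar \<ii>)) = Xvar \<ii>"
    by (rule mut_X_involution) (rule one_plus_power_int_nonzero[OF X])
  ultimately show ?thesis by (simp add: mutate_def mut_mat_involution)
qed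

lemma relabel_inv:
  assumes "bij \<sigma>"
  shows "relabel (inv_into UNIV \<sigma>) (relabel \<sigma> \<ii>) = \<ii>"
proof -
  have "\<sigma> (inv_into UNIV \<sigma> i) = i" for i using assms by (simp add: bij_is_surj surj_f_inv_f)
  then show ?thesis by (cases \<ii>) (simp add: relabel_def fun_eq_iff)
qed

section \<open>Charts of the cluster manifold\<close>

locale mutation_class =
  fixes d :: "'i::finite \<Rightarrow> nat" and s :: "('i, 'a::field_char_0, 'x::field_char_0) seed set"
  assumes d_pos: "0 < d i" and in_classes: "s \<in> mutation_classes d"
begin

lemma sym_mutation_equiv:
  "sym (mutation_equiv d :: (('i, 'a::field_char_0, 'x::field_char_0) seed) rel)"
  unfolding mutation_equiv_def
proof (intro sym_rtrancl symI)
  fix \<ii> \<jj> :: "('i, 'a, 'x) seed"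
  assume *: "(\<ii>, \<jj>) \<in> {(\<ii>, \<jj>). \<ii> \<in> seeds d \<and> \<jj> \<in> seeds d \<and>
    ((\<exists>k. \<jj> = mutate k \<ii>) \<or> (\<exists>\<sigma>. bij \<sigma> \<and> \<jj> = relabel \<sigma> \<ii>))}"
  have "(\<exists>k. \<ii> = mutate k \<jj>) \<or> (\<exists>\<sigma>. bij \<sigma> \<and> \<ii> = relabel \<sigma> \<jj>)"
  proof -
    from * consider k where "\<jj> = mutate k \<ii>" | \<sigma> where "bij \<sigma>" "\<jj> = relabel \<sigma> \<ii>"
      by blast
    then show ?thesis
    proof cases
      case 1
      then have "\<ii> = mutate k \<jj>" using mutate_mutate[of \<ii> d k] * d_pos by simp
      then show ?thesis by blast
    next
      case 2
      then have "\<ii> = relabel (inv_into UNIV \<sigma>) \<jj>" by (simp add: relabel_inv)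
      then show ?thesis using bij_imp_bij_inv[OF 2(1)] by blast
    qed
  qed
  then show "(\<jj>, \<ii>) \<in> {(\<ii>, \<jj>). \<ii> \<in> seeds d \<and> \<jj> \<in> seeds d \<and>
    ((\<exists>k. \<jj> = mutate k \<ii>) \<or> (\<exists>\<sigma>. bij \<sigma> \<and> \<jj> = relabel \<sigma> \<ii>))}"
    using * by simp
qed

lemma seeds_of_equiv:
  assumes "(\<ii>, \<jj>) \<in> mutation_equiv d" "\<ii> \<in> seeds d"
  shows "\<jj> \<in> seeds d"
  using assms unfolding mutation_equiv_def by (induction rule: rtrancl_induct) auto

lemma subset_seeds: "s \<subseteq> seeds d"
  using in_classes seeds_of_equiv by (auto simp: mutation_classes_def quotient_def)

lemma class_eq:
  assumes "\<ii> \<in> s"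
  shows "s = mutation_equiv d `` {\<ii>}"
proof -
  obtain \<ii>' where i: "s = mutation_equiv d `` {\<ii>'}"
    using in_classes by (auto simp: mutation_classes_def quotient_def)
  have "trans (mutation_equiv d)" unfolding mutation_equiv_def by (rule trans_rtrancl)
  moreover have "(\<ii>', \<ii>) \<in> mutation_equiv d" using assms i by blast
  moreover from this have "(\<ii>, \<ii>') \<in> mutation_equiv d" by (rule symD[OF sym_mutation_equiv])
  ultimately show ?thesis unfolding i by (blast dest: transD)
qed

lemma mutate_in_class:
  assumes "\<ii> \<in> s"
  shows "mutate k \<ii> \<in> s"
proof -
  have "\<ii> \<in> seeds d" "mutate k \<ii> \<in> seeds d"
    using assms subset_seeds mutate_in_seeds[of \<ii> d k] d_pos by auto
  then have "(\<ii>, mutate k \<ii>) \<in> mutation_equiv d"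
    unfolding mutation_equiv_def by (intro r_into_rtrancl) auto
  then show ?thesis using class_eq[OF assms] by blast
qed

lemma free_Avar: "\<ii> \<in> s \<Longrightarrow> free_generators (Avar \<ii>)"
  using subset_seeds unfolding seeds_def by blast

lemma cluster_A_mutate:
  "g \<in> cluster_A s \<Longrightarrow> \<ii> \<in> s \<Longrightarrow> g (mutate k \<ii>) = mut_A k (exmat \<ii>) (g \<ii>)"
  by (simp add: cluster_A_def)

lemma cluster_A_relabel:
  "g \<in> cluster_A s \<Longrightarrow> \<ii> \<in> s \<Longrightarrow> bij \<sigma> \<Longrightarrow> relabel \<sigma> \<ii> \<in> s \<Longrightarrow> g (relabel \<sigma> \<ii>) = g \<ii> \<circ> \<sigma>"
  by (simp add: cluster_A_def)

lemma cluster_A_orthant: "g \<in> cluster_A s \<Longrightarrow> \<ii> \<in> s \<Longrightarrow> g \<ii> \<in> orthant"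
  by (auto simp: cluster_A_def PiE_def Pi_def)

text \<open>The change of coordinates from \<open>\<ii>\<close> to \<open>\<jj>\<close> is found along a mutation path, as a map \<open>f\<close> that
  represents the cluster of \<open>\<jj>\<close> in terms of that of \<open>\<ii>\<close>. By uniqueness of representing functions it
  does not depend on the path, which is what allows the gluing in \<open>chart_surj\<close>. The last conjunct
  says that it is also the transition map of the manifold.\<close>

lemma chart_transition:
  assumes i: "\<ii> \<in> s" and j: "\<jj> \<in> s"
  shows "\<exists>f. (\<forall>x\<in>orthant. f x \<in> orthant) \<and> (\<forall>l. represents (Avar \<ii>) (Avar \<jj> l) (\<lambda>x. f x l)) \<and>
    (\<forall>g\<in>cluster_A s. g \<jj> = f (g \<ii>))"
proof -
  have "(\<ii>, \<jj>) \<in> mutation_equiv d" using class_eq[OF i] j by blast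
  then show ?thesis
    unfolding mutation_equiv_def
  proof (induction rule: rtrancl_induct)
    case base
    show ?case by (rule exI[of _ "\<lambda>x. x"]) (simp add: represents_var)
  next
    case (step \<jj> \<kk>)
    have "(\<ii>, \<jj>) \<in> mutation_equiv d" "(\<ii>, \<kk>) \<in> mutation_equiv d"
      unfolding mutation_equiv_def using step.hyps(1) rtrancl_into_rtrancl[OF step.hyps] .
    then have s: "\<jj> \<in> s" "\<kk> \<in> s"
      by (simp_all add: class_eq[OF i])
    obtain f where f: "\<forall>x\<in>orthant. f x \<in> orthant"
        "\<And>l. represents (Avar \<ii>) (Avar \<jj> l) (\<lambda>x. f x l)" "\<And>g. g \<in> cluster_A s \<Longrightarrow> g \<jj> = f (g \<ii>)"
      using step.IH by blast
    from step.hyps(2) consider k where "\<kk> = mutate k \<jj>" | \<sigma> where "bij \<sigma>" "\<kk> = relabel \<sigma> \<jj>"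
      by blast
    then show ?case
    proof cases
      case 1
      show ?thesis
      proof (intro exI conjI ballI allI)
        show "represents (Avar \<ii>) (Avar \<kk> l) (\<lambda>x. mut_A k (exmat \<jj>) (f x) l)" for l
          using represents_mut_A[OF free_Avar[OF i] f(2,1)] by (simp add: 1 mutate_def)
        show "mut_A k (exmat \<jj>) (f x) \<in> orthant" if "x \<in> orthant" for x
          using f(1) that by (intro mut_A_orthant) blast
        show "g \<kk> = mut_A k (exmat \<jj>) (f (g \<ii>))" if "g \<in> cluster_A s" for g
          using cluster_A_mutate[OF that s(1), of k] f(3)[OF that] 1 by simp
      qed
    next
      case 2
      show ?thesis
      proof (intro exI conjI ballI allI)
        show "represents (Avar \<ii>) (Avar \<kk> l) (\<lambda>x. (f x \<circ> \<sigma>) l)" for l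
          using f(2) by (simp add: 2 relabel_def)
        show "f x \<circ> \<sigma> \<in> orthant" if "x \<in> orthant" for x
          using f(1) that by simp
        show "g \<kk> = f (g \<ii>) \<circ> \<sigma>" if "g \<in> cluster_A s" for g
          using cluster_A_relabel[OF that s(1) 2(1)] s(2) f(3)[OF that] 2 by simp
      qed
    qed
  qed
qed

lemma cluster_A_eqI:
  assumes "g \<in> cluster_A s" "h \<in> cluster_A s" "\<ii> \<in> s" "g \<ii> = h \<ii>"
  shows "g = h"
proof (rule PiE_ext)
  show "g \<in> s \<rightarrow>\<^sub>E orthant" "h \<in> s \<rightarrow>\<^sub>E orthant" using assms by (auto simp: cluster_A_def)
  fix \<jj> assume "\<jj> \<in> s"
  then obtain f where "\<forall>g\<in>cluster_A s. g \<jj> = f (g \<ii>)" using chart_transition[OF assms(3)] by blast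
  then show "g \<jj> = h \<jj>" using assms by simp
qed

text \<open>The point with coordinates \<open>x\<close> in the chart \<open>\<ii>\<close> has in the chart \<open>\<jj>\<close> the values at \<open>x\<close> of the
  functions that represent the cluster of \<open>\<jj>\<close>. These families are compatible, since the exchange
  relation holds for the clusters and hence for the unique functions representing them.\<close>

lemma chart_surj:
  assumes i: "\<ii> \<in> s" and x: "x \<in> orthant"
  shows "\<exists>g\<in>cluster_A s. g \<ii> = x"
proof -
  obtain f where f: "\<And>\<jj> x. \<jj> \<in> s \<Longrightarrow> x \<in> orthant \<Longrightarrow> f \<jj> x \<in> orthant"
      "\<And>\<jj> l. \<jj> \<in> s \<Longrightarrow> represents (Avar \<ii>) (Avar \<jj> l) (\<lambda>x. f \<jj> x l)"
  proof -
    have "\<forall>\<jj>\<in>s. \<exists>f. (\<forall>x\<in>orthant. f x \<in> orthant) \<and> (\<forall>l. represents (Avar \<ii>) (Avar \<jj> l) (\<lambda>x. f x l))"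
      using chart_transition[OF i] by blast
    then show ?thesis using that unfolding bchoice_iff by blast
  qed
  note uniq = represents_unique[OF free_Avar[OF i] _ _ x]
  define g where "g = (\<lambda>\<jj>\<in>s. f \<jj> x)"
  have "g (mutate k \<jj>) = mut_A k (exmat \<jj>) (g \<jj>)" if j: "\<jj> \<in> s" for \<jj> k
  proof
    fix l
    have "represents (Avar \<ii>) (Avar (mutate k \<jj>) l) (\<lambda>x. mut_A k (exmat \<jj>) (f \<jj> x) l)"
      using represents_mut_A[OF free_Avar[OF i], of "Avar \<jj>" "f \<jj>" k "exmat \<jj>" l] f(1,2)[OF j]
      by (simp add: mutate_def)
    then show "g (mutate k \<jj>) l = mut_A k (exmat \<jj>) (g \<jj>) l"
      using uniq[OF f(2)[OF mutate_in_class[OF j]]] j mutate_in_class[OF j] by (simp add: g_def)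
  qed
  moreover have "g (relabel \<sigma> \<jj>) = g \<jj> \<circ> \<sigma>" if j: "\<jj> \<in> s" and r: "relabel \<sigma> \<jj> \<in> s" for \<jj> \<sigma>
  proof
    fix l
    have "represents (Avar \<ii>) (Avar (relabel \<sigma> \<jj>) l) (\<lambda>x. f \<jj> x (\<sigma> l))"
      using f(2)[OF j] by (simp add: relabel_def)
    then show "g (relabel \<sigma> \<jj>) l = (g \<jj> \<circ> \<sigma>) l"
      using uniq[OF f(2)[OF r]] j r by (simp add: g_def)
  qed
  moreover have "g \<in> s \<rightarrow>\<^sub>E orthant" using f(1) x by (auto simp: g_def)
  ultimately have "g \<in> cluster_A s" by (simp add: cluster_A_def)
  moreover have "g \<ii> = x"
    using uniq[OF f(2)[OF i] represents_var] i by (auto simp: g_def)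
  ultimately show ?thesis by blast
qed

lemma laurent_eval_laurent_expr:
  assumes F: "F \<in> upper_cluster_algebra s" and i: "\<ii> \<in> s"
  shows "laurent_eval (laurent_expr \<ii> F) (Avar \<ii>) = F"
proof -
  obtain c where c: "laurent_eval c (Avar \<ii>) = F" using F i by (auto simp: upper_cluster_algebra_def)
  then show ?thesis
    unfolding laurent_expr_def
    by (rule theI[where P = "\<lambda>c. laurent_eval c (Avar \<ii>) = F"]) 
       (auto simp: c intro: laurent_eval_inj[OF free_Avar[OF i]])
qed

lemma laurent_eval_chart_independent:
  assumes F: "F \<in> upper_cluster_algebra s" and i: "\<ii> \<in> s" and j: "\<jj> \<in> s" and g: "g \<in> cluster_A s"
  shows "laurent_eval (laurent_expr \<jj> F) (g \<jj>) = laurent_eval (laurent_expr \<ii> F) (g \<ii>)"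
proof -
  obtain f where f: "\<forall>x\<in>orthant. f x \<in> orthant" "\<And>l. represents (Avar \<ii>) (Avar \<jj> l) (\<lambda>x. f x l)"
      "\<And>g. g \<in> cluster_A s \<Longrightarrow> g \<jj> = f (g \<ii>)"
    using chart_transition[OF i j] by blast
  have "represents (Avar \<ii>) (laurent_eval (laurent_expr \<jj> F) (Avar \<jj>)) (\<lambda>x. laurent_eval (laurent_expr \<jj> F) (f x))"
    by (rule represents_laurent_eval[OF free_Avar[OF i] f(2,1)])
  then have "represents (Avar \<ii>) F (\<lambda>x. laurent_eval (laurent_expr \<jj> F) (f x))"
    by (simp only: laurent_eval_laurent_expr[OF F j])
  moreover have "represents (Avar \<ii>) (laurent_eval (laurent_expr \<ii> F) (Avar \<ii>)) (\<lambda>x. laurent_eval (laurent_expr \<ii> F) x)"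
    by (rule represents_laurent_eval[OF free_Avar[OF i], where f = "\<lambda>x. x"]) (auto simp: represents_var)
  then have "represents (Avar \<ii>) F (\<lambda>x. laurent_eval (laurent_expr \<ii> F) x)"
    by (simp only: laurent_eval_laurent_expr[OF F i])
  ultimately have "laurent_eval (laurent_expr \<jj> F) (f (g \<ii>)) = laurent_eval (laurent_expr \<ii> F) (g \<ii>)"
    by (rule represents_unique[OF free_Avar[OF i] _ _ cluster_A_orthant[OF g i]])
  then show ?thesis using f(3)[OF g] by simp
qed

end

section \<open>Sums of exponentials\<close>

lemma exp_midpoint_le: "exp ((p + q) / 2) \<le> (exp p + exp q) / (2::real)"
  and exp_midpoint_less: "p \<noteq> q \<Longrightarrow> exp ((p + q) / 2) < (exp p + exp q) / (2::real)"
proof -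
  have e: "exp ((p + q) / 2) = exp (p/2) * exp (q/2)" "exp p = exp (p/2) ^ 2" "exp q = exp (q/2) ^ 2"
    by (simp_all add: power2_eq_square exp_add[symmetric] add_divide_distrib)
  have "0 \<le> (exp (p/2) - exp (q/2)) ^ 2" by simp
  then show "exp ((p + q) / 2) \<le> (exp p + exp q) / 2"
    unfolding e by (simp add: power2_eq_square algebra_simps)
  assume "p \<noteq> q"
  then have "0 < (exp (p/2) - exp (q/2)) ^ 2" by simp
  then show "exp ((p + q) / 2) < (exp p + exp q) / 2"
    unfolding e by (simp add: power2_eq_square algebra_simps)
qed

text \<open>A ball of radius \<open>r\<close> around 0 lies in the convex hull of the exponents, so in every direction
  \<open>u\<close> some exponent \<open>a\<close> satisfies \<open>a \<bullet> u \<ge> r * norm u\<close>; otherwise all of them, with their convex hull,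
  would lie in an open half space that misses a point of the ball. This single fact gives growth at
  infinity, hence a minimum, and strict convexity along every line, hence its uniqueness.\<close>

lemma exponential_sum_has_strict_minimum:
  fixes a :: "'t \<Rightarrow> 'n::euclidean_space" and c :: "'t \<Rightarrow> real"
  assumes fin: "finite T" and c: "\<And>t. t \<in> T \<Longrightarrow> 0 < c t"
    and S: "S \<subseteq> a ` T" and S0: "0 \<in> interior (convex hull S)"
  shows "\<exists>u. \<forall>v. v \<noteq> u \<longrightarrow> (\<Sum>t\<in>T. c t * exp (a t \<bullet> u)) < (\<Sum>t\<in>T. c t * exp (a t \<bullet> v))"
proof -
  define \<phi> where "\<phi> u = (\<Sum>t\<in>T. c t * exp (a t \<bullet> u))" for u
  obtain r where r: "r > 0" "cball 0 r \<subseteq> convex hull S"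
    using S0 by (auto simp: mem_interior_cball)
  have dir: "\<exists>t\<in>T. r * norm u \<le> a t \<bullet> u" for u
  proof (rule ccontr)
    assume "\<not> ?thesis"
    then have "S \<subseteq> {z. u \<bullet> z < r * norm u}" using S by (auto simp: not_le inner_commute)
    then have "convex hull S \<subseteq> {z. u \<bullet> z < r * norm u}"
      by (intro hull_minimal convex_halfspace_lt)
    moreover have "(r / norm u) *\<^sub>R u \<in> convex hull S" using r by (intro subsetD[OF r(2)]) auto
    ultimately have "u \<bullet> ((r / norm u) *\<^sub>R u) < r * norm u" by blast
    then show False by (cases "u = 0") (simp_all add: dot_square_norm power2_eq_square)
  qed
  have T: "T \<noteq> {}" using dir by blast
  define m where "m = Min (c ` T)"
  have m: "m > 0" "\<And>t. t \<in> T \<Longrightarrow> m \<le> c t"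
    using fin T c by (auto simp: m_def)
  have grow: "m * (1 + r * norm u) \<le> \<phi> u" for u
  proof -
    obtain t where t: "t \<in> T" "r * norm u \<le> a t \<bullet> u" using dir by blast
    have "1 + r * norm u \<le> exp (a t \<bullet> u)"
      using exp_ge_add_one_self[of "a t \<bullet> u"] t(2) by linarith
    then have "m * (1 + r * norm u) \<le> c t * exp (a t \<bullet> u)"
      using m t(1) r(1) c[OF t(1)] by (intro mult_mono) auto
    also have "\<dots> \<le> \<phi> u"
      unfolding \<phi>_def using c by (intro member_le_sum t fin) (auto simp: less_imp_le)
    finally show ?thesis .
  qed
  \<comment> \<open>outside the ball of this radius the lower bound exceeds the value at 0\<close>
  define R where "R = \<phi> 0 / (m * r)"
  have "\<phi> 0 \<ge> 0" using grow[of 0] m by simp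
  then have "R \<ge> 0" using m r by (simp add: R_def)
  have "continuous_on (cball 0 R) \<phi>"
    unfolding \<phi>_def by (intro continuous_intros)
  then obtain u where u: "u \<in> cball 0 R" "\<And>v. v \<in> cball 0 R \<Longrightarrow> \<phi> u \<le> \<phi> v"
    using continuous_attains_inf[of "cball 0 R" \<phi>] \<open>R \<ge> 0\<close> by auto
  have min: "\<phi> u \<le> \<phi> v" for v
  proof (cases "norm v \<le> R")
    case False
    then have "\<phi> 0 \<le> m * r * norm v" using m r by (simp add: R_def field_simps)
    also have "\<dots> \<le> \<phi> v" using grow[of v] m by (simp add: algebra_simps)
    finally show ?thesis using u(2)[of 0] \<open>R \<ge> 0\<close> by simp
  qed (use u in simp)
  have "\<phi> u < \<phi> v" if "v \<noteq> u" for v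
  proof -
    define w where "w = (1/2) *\<^sub>R (u + v)"
    obtain t where t: "t \<in> T" "r * norm (u - v) \<le> a t \<bullet> (u - v)" using dir by blast
    moreover have "0 < r * norm (u - v)" using r that by simp
    ultimately have ne: "a t \<bullet> u \<noteq> a t \<bullet> v" by (simp add: inner_diff_right)
    have aw: "a t \<bullet> w = (a t \<bullet> u + a t \<bullet> v) / 2" for t by (simp add: w_def inner_add_right)
    have "\<phi> w < (\<Sum>t\<in>T. c t * ((exp (a t \<bullet> u) + exp (a t \<bullet> v)) / 2))"
      unfolding \<phi>_def
    proof (rule sum_strict_mono_ex1[OF fin])
      show "\<forall>t\<in>T. c t * exp (a t \<bullet> w) \<le> c t * ((exp (a t \<bullet> u) + exp (a t \<bullet> v)) / 2)"
        unfolding aw using c by (intro ballI mult_left_mono exp_midpoint_le) (auto simp: less_imp_le)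
      show "\<exists>t\<in>T. c t * exp (a t \<bullet> w) < c t * ((exp (a t \<bullet> u) + exp (a t \<bullet> v)) / 2)"
        unfolding aw using c t(1) ne by (intro bexI[of _ t] mult_strict_left_mono exp_midpoint_less) auto
    qed
    also have "\<dots> = (\<phi> u + \<phi> v) / 2"
      by (simp add: \<phi>_def sum.distrib[symmetric] sum_divide_distrib distrib_left)
    finally show ?thesis using min[of w] by simp
  qed
  then show ?thesis unfolding \<phi>_def by blast
qed

lemma laurent_eval_exp:
  fixes u :: "real^'i::finite"
  shows "laurent_eval c (\<lambda>j. exp (u $ j)) =
    (\<Sum>\<alpha>\<in>Poly_Mapping.keys c. real_of_int (Poly_Mapping.lookup c \<alpha>) * exp ((\<chi> j. real_of_int (\<alpha> j)) \<bullet> u))"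
  by (simp add: laurent_eval_def inner_vec_def exp_sum exp_power_int)

section \<open>The ensemble map\<close>

lemma monomial_add:
  fixes x :: "'i::finite \<Rightarrow> real"
  assumes "x \<in> orthant"
  shows "(\<Prod>j\<in>UNIV. x j powi (e j + f j)) = (\<Prod>j\<in>UNIV. x j powi e j) * (\<Prod>j\<in>UNIV. x j powi f j)"
proof -
  have "x j powi (e j + f j) = x j powi e j * x j powi f j" for j
    using assms by (intro power_int_add) (auto simp: less_imp_neq[symmetric])
  then show ?thesis by (simp add: prod.distrib)
qed

lemma monomial_scale:
  fixes x :: "'i::finite \<Rightarrow> real"
  shows "(\<Prod>j\<in>UNIV. x j powi (n * e j)) = (\<Prod>j\<in>UNIV. x j powi e j) powi n"
proof -
  have "(\<Prod>j\<in>J. x j powi e j) powi n = (\<Prod>j\<in>J. x j powi (n * e j))" for J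
    by (induction J rule: infinite_finite_induct)
       (auto simp: power_int_mult_distrib power_int_mult[symmetric] mult.commute)
  then show ?thesis by simp
qed

text \<open>The ensemble map intertwines the two kinds of mutation. With \<open>P\<close> and \<open>N\<close> the two monomials of the
  exchange relation, the \<open>k\<close>-th coordinate of the image is \<open>P/N\<close>, and for \<open>i \<noteq> k\<close> both sides change by a
  power of \<open>(P + N)/P\<close> or of \<open>(P + N)/N\<close>, depending on the sign of \<open>\<epsilon>\<^sub>i\<^sub>k\<close>.\<close>

lemma ensemble_mutation:
  fixes x :: "'i::finite \<Rightarrow> real"
  assumes x: "x \<in> orthant" and \<epsilon>: "\<epsilon> k k = 0"
  shows "(\<lambda>i. \<Prod>j\<in>UNIV. mut_A k \<epsilon> x j powi mut_mat k \<epsilon> i j) = mut_X k \<epsilon> (\<lambda>i. \<Prod>j\<in>UNIV. x j powi \<epsilon> i j)"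
proof
  fix i
  let ?M = "\<lambda>e. \<Prod>j\<in>UNIV. x j powi e j"
  define P N where "P = ?M (\<lambda>j. pos_part (\<epsilon> k j))" and "N = ?M (\<lambda>j. pos_part (- \<epsilon> k j))"
  have pos: "P > 0" "N > 0" using x by (auto simp: P_def N_def intro!: prod_pos)
  have split: "z = pos_part z + (-1) * pos_part (- z)" for z by (auto simp: pos_part_def)
  have "?M (\<epsilon> k) = ?M (\<lambda>j. pos_part (\<epsilon> k j) + (-1) * pos_part (- \<epsilon> k j))"
    by (subst split) simp
  also have "\<dots> = P / N"
    unfolding monomial_add[OF x] monomial_scale by (simp add: P_def N_def power_int_minus divide_inverse)
  finally have Xk: "?M (\<epsilon> k) = P / N" .
  show "(\<Prod>j\<in>UNIV. mut_A k \<epsilon> x j powi mut_mat k \<epsilon> i j) = mut_X k \<epsilon> (\<lambda>i. ?M (\<epsilon> i)) i"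
  proof (cases "i = k")
    case True
    have "(\<Prod>j\<in>UNIV. mut_A k \<epsilon> x j powi mut_mat k \<epsilon> k j) = ?M (\<lambda>j. (-1) * \<epsilon> k j)"
    proof (rule prod.cong)
      fix j show "mut_A k \<epsilon> x j powi mut_mat k \<epsilon> k j = x j powi ((-1) * \<epsilon> k j)"
        by (cases "j = k") (simp_all add: mut_A_def mut_mat_def \<epsilon>)
    qed simp
    then show ?thesis unfolding monomial_scale using True by (simp add: mut_X_def power_int_minus)
  next
    case False
    let ?e = "\<epsilon> i k"
    \<comment> \<open>split off the exchange polynomial; the remaining exponent has the same form for \<open>j = k\<close>, as \<open>\<epsilon> k k = 0\<close>\<close>
    have "mut_A k \<epsilon> x j powi mut_mat k \<epsilon> i j = (if j = k then (P + N) powi (- ?e) else 1) *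
        x j powi (\<epsilon> i j + (pos_part ?e * pos_part (\<epsilon> k j) + (- pos_part (- ?e)) * pos_part (- \<epsilon> k j)))" for j
    proof (cases "j = k")
      case True
      then show ?thesis
        using x by (simp add: mut_A_def mut_mat_def \<epsilon> pos_part_def P_def[symmetric, unfolded pos_part_def]
            N_def[symmetric, unfolded pos_part_def] power_int_mult_distrib power_int_minus power_int_inverse)
    qed (use False in \<open>simp add: mut_A_def mut_mat_def add_diff_eq\<close>)
    then have "(\<Prod>j\<in>UNIV. mut_A k \<epsilon> x j powi mut_mat k \<epsilon> i j) = (P + N) powi (- ?e) *
        ?M (\<lambda>j. \<epsilon> i j + (pos_part ?e * pos_part (\<epsilon> k j) + (- pos_part (- ?e)) * pos_part (- \<epsilon> k j)))"
      by (simp only: prod.distrib) simp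
    also have "\<dots> = (P + N) powi (- ?e) * (?M (\<epsilon> i) * (P powi pos_part ?e * N powi (- pos_part (- ?e))))"
      unfolding monomial_add[OF x] monomial_scale by (simp add: P_def N_def)
    also have "\<dots> = ?M (\<epsilon> i) * (1 + (P / N) powi (- sgn ?e)) powi (- ?e)"
    proof -
      consider "?e = 0" | "?e > 0" | "?e < 0" by linarith
      then have "(P + N) powi (- ?e) * (P powi pos_part ?e * N powi (- pos_part (- ?e))) =
          (1 + (P / N) powi (- sgn ?e)) powi (- ?e)"
      proof cases
        case 2
        have "1 + (P / N) powi (- 1) = (P + N) / P" using pos by (simp add: power_int_minus field_simps)
        then show ?thesis
          using 2 pos by (simp add: pos_part_def power_int_divide_distrib) (simp add: power_int_minus field_simps)
      next
        case 3
        have "1 + P / N = (P + N) / N" using pos by (simp add: field_simps)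
        then show ?thesis
          using 3 pos by (simp add: pos_part_def power_int_divide_distrib) (simp add: power_int_minus field_simps)
      qed (simp add: pos_part_def)
      then show ?thesis by (simp add: mult.left_commute)
    qed
    also have "\<dots> = mut_X k \<epsilon> (\<lambda>i. ?M (\<epsilon> i)) i"
      using False by (simp add: mut_X_def Xk)
    finally show ?thesis .
  qed
qed

lemma (in mutation_class) ensemble_map_in_cluster_X:
  assumes g: "g \<in> cluster_A s"
  shows "ensemble_map s g \<in> cluster_X s"
proof -
  have pos: "g \<ii> \<in> orthant" if "\<ii> \<in> s" for \<ii> using cluster_A_orthant[OF g that] .
  have "ensemble_map s g \<in> s \<rightarrow>\<^sub>E orthant"
    using pos by (auto simp: ensemble_map_def intro!: prod_pos)
  moreover have "ensemble_map s g (mutate k \<ii>) = mut_X k (exmat \<ii>) (ensemble_map s g \<ii>)" if i: "\<ii> \<in> s" for \<ii> k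
  proof -
    have "exmat \<ii> k k = 0" using i subset_seeds exmat_diagonal[of \<ii> d k] d_pos by auto
    from ensemble_mutation[of "g \<ii>" "exmat \<ii>" k, OF pos[OF i] this] show ?thesis
      using i mutate_in_class[OF i, of k] cluster_A_mutate[OF g i, of k]
      by (simp add: ensemble_map_def mutate_def)
  qed
  moreover have "ensemble_map s g (relabel \<sigma> \<ii>) = ensemble_map s g \<ii> \<circ> \<sigma>"
    if i: "\<ii> \<in> s" and \<sigma>: "bij \<sigma>" and r: "relabel \<sigma> \<ii> \<in> s" for \<ii> \<sigma>
  proof
    fix k
    have "(\<Prod>j\<in>UNIV. g \<ii> (\<sigma> j) powi exmat \<ii> (\<sigma> k) (\<sigma> j)) = (\<Prod>j\<in>UNIV. g \<ii> j powi exmat \<ii> (\<sigma> k) j)"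
      by (rule prod.reindex_bij_betw[OF \<sigma>])
    then show "ensemble_map s g (relabel \<sigma> \<ii>) k = (ensemble_map s g \<ii> \<circ> \<sigma>) k"
      using i r cluster_A_relabel[OF g i \<sigma> r] by (simp add: ensemble_map_def) (simp add: relabel_def)
  qed
  ultimately show ?thesis by (simp add: cluster_X_def)
qed

section \<open>Fixed points of finite groups\<close>

text \<open>The action of the inverse of \<open>\<delta>\<close>. Writing it without inverses lets the defining
  properties of modular group elements apply directly; for fixed points the direction is immaterial
  (\<open>modular_action_eq_self\<close>).\<close>

definition pullback ::
    "('i, 'a, 'x) seed set \<Rightarrow> (('i, 'a, 'x) seed \<Rightarrow> ('i, 'a, 'x) seed) \<Rightarrow>
     (('i, 'a, 'x) seed \<Rightarrow> 'i \<Rightarrow> real) \<Rightarrow> ('i, 'a, 'x) seed \<Rightarrow> 'i \<Rightarrow> real" where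
  "pullback s \<delta> g = (\<lambda>\<ii>\<in>s. g (\<delta> \<ii>))"

lemma carrier_modular_groupD:
  assumes "\<phi> \<in> carrier (cluster_modular_group s)"
  shows "\<phi> \<in> Bij s" "\<ii> \<in> s \<Longrightarrow> \<phi> \<ii> \<in> s" "\<ii> \<in> s \<Longrightarrow> exmat (\<phi> \<ii>) = exmat \<ii>"
    "\<ii> \<in> s \<Longrightarrow> \<phi> (mutate k \<ii>) = mutate k (\<phi> \<ii>)"
    "\<ii> \<in> s \<Longrightarrow> bij \<sigma> \<Longrightarrow> relabel \<sigma> \<ii> \<in> s \<Longrightarrow> \<phi> (relabel \<sigma> \<ii>) = relabel \<sigma> (\<phi> \<ii>)"
  using assms Bij_imp_funcset[of \<phi> s] by (auto simp: cluster_modular_group_def)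

lemma modular_action_eq_self:
  assumes "\<phi> \<in> Bij s" "g \<in> extensional s" "\<And>\<ii>. \<ii> \<in> s \<Longrightarrow> g (\<phi> \<ii>) = g \<ii>"
  shows "modular_action s \<phi> g = g"
proof (rule extensionalityI[OF _ assms(2)])
  show "modular_action s \<phi> g \<in> extensional s" by (simp add: modular_action_def)
  fix \<ii> assume i: "\<ii> \<in> s"
  have "inv_into s \<phi> \<ii> \<in> s" using assms(1) i by (rule Bij_inv_into_mem)
  moreover have "\<phi> (inv_into s \<phi> \<ii>) = \<ii>"
    using assms(1) i by (auto simp: Bij_def bij_betw_def intro: f_inv_into_f)
  ultimately show "modular_action s \<phi> g \<ii> = g \<ii>"
    using assms(3)[of "inv_into s \<phi> \<ii>"] i by (simp add: modular_action_def)
qed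

lemma (in mutation_class) pullback_in_cluster_A:
  assumes \<phi>: "\<phi> \<in> carrier (cluster_modular_group s)" and g: "g \<in> cluster_A s"
  shows "pullback s \<phi> g \<in> cluster_A s"
proof -
  note \<phi> = carrier_modular_groupD[OF \<phi>]
  have "pullback s \<phi> g \<in> s \<rightarrow>\<^sub>E orthant"
    using cluster_A_orthant[OF g] \<phi>(2) by (auto simp: pullback_def)
  moreover have "pullback s \<phi> g (mutate k \<ii>) = mut_A k (exmat \<ii>) (pullback s \<phi> g \<ii>)" if i: "\<ii> \<in> s" for \<ii> k
    using cluster_A_mutate[OF g \<phi>(2)[OF i], of k] mutate_in_class[OF i, of k] i \<phi>(3,4)[OF i]
    by (simp add: pullback_def)
  moreover have "pullback s \<phi> g (relabel \<sigma> \<ii>) = pullback s \<phi> g \<ii> \<circ> \<sigma>"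
    if i: "\<ii> \<in> s" and \<sigma>: "bij \<sigma>" and r: "relabel \<sigma> \<ii> \<in> s" for \<ii> \<sigma>
    using cluster_A_relabel[OF g \<phi>(2)[OF i] \<sigma>] \<phi>(2)[OF r] r i \<phi>(5)[OF i \<sigma> r]
    by (simp add: pullback_def)
  ultimately show ?thesis by (simp add: cluster_A_def)
qed

text \<open>The averaging argument. In the sum defining \<open>\<Phi>\<close> the Laurent expression of \<open>F\<close> is evaluated in the
  chart \<open>\<ii>\<close> at the coordinates of \<open>g\<close> in the chart \<open>\<gamma> \<ii>\<close>. To see it as a positive sum of exponentials
  in the coordinates of \<open>g\<close> at \<open>\<ii>\<close> itself, the pulled back point is evaluated in another
  chart \<open>\<beta> \<gamma>\<close>, namely the one that \<open>\<gamma>\<close> sends to \<open>\<ii>\<close>.\<close>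

lemma (in mutation_class) exists_pullback_invariant_point:
  assumes fill: "filling_set s \<Lambda>" and G: "subgroup G (cluster_modular_group s)" and finG: "finite G"
  shows "\<exists>x\<in>cluster_A s. \<forall>\<gamma>\<in>G. pullback s \<gamma> x = x"
proof -
  note GD = carrier_modular_groupD[OF subsetD[OF subgroup.subset[OF G]]]
  obtain \<ii> S where \<Lambda>: "finite \<Lambda>" "\<Lambda> \<subseteq> upper_cluster_algebra_pos s" and i: "\<ii> \<in> s"
    and S: "S \<subseteq> (\<Union>F\<in>\<Lambda>. Supp \<ii> F)" "0 \<in> interior (convex hull S)"
    using fill unfolding filling_set_def by blast
  have U: "F \<in> upper_cluster_algebra s" if "F \<in> \<Lambda>" for F
    using that \<Lambda>(2) by (auto simp: upper_cluster_algebra_pos_def)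
  define \<Phi> where "\<Phi> g = (\<Sum>\<gamma>\<in>G. \<Sum>F\<in>\<Lambda>. laurent_eval (laurent_expr \<ii> F) (g (\<gamma> \<ii>)) :: real)" for g
  define \<beta> where "\<beta> \<gamma> = inv_into s \<gamma> \<ii>" for \<gamma>
  have \<beta>: "\<beta> \<gamma> \<in> s" "\<gamma> (\<beta> \<gamma>) = \<ii>" if "\<gamma> \<in> G" for \<gamma>
    using GD(1)[OF that] i Bij_inv_into_mem[of \<gamma> s \<ii>]
    by (auto simp: \<beta>_def Bij_def bij_betw_def intro: f_inv_into_f)
  have one: "(\<lambda>x\<in>s. x) \<in> G" and \<beta>_one: "\<beta> (\<lambda>x\<in>s. x) = \<ii>"
  proof -
    show one: "(\<lambda>x\<in>s. x) \<in> G"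
      using subgroup.one_closed[OF G] by (simp add: cluster_modular_group_def BijGroup_def)
    show "\<beta> (\<lambda>x\<in>s. x) = \<ii>" using \<beta>[OF one] by simp
  qed

  \<comment> \<open>index the exponential terms by a group element, an element of \<open>\<Lambda>\<close>, and an exponent vector\<close>
  define T where "T = (SIGMA p:G \<times> \<Lambda>. Poly_Mapping.keys (laurent_expr (\<beta> (fst p)) (snd p)))"
  define c where "c = (\<lambda>((\<gamma>, F), \<alpha>). real_of_int (Poly_Mapping.lookup (laurent_expr (\<beta> \<gamma>) F) \<alpha>))"
  define a :: "((('i, 'a, 'x) seed \<Rightarrow> ('i, 'a, 'x) seed) \<times> 'a) \<times> ('i \<Rightarrow> int) \<Rightarrow> real^'i" where "a = (\<lambda>(_, \<alpha>). \<chi> j. real_of_int (\<alpha> j))"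
  have \<Phi>_exp: "\<Phi> g = (\<Sum>t\<in>T. c t * exp (a t \<bullet> u))"
    if g: "g \<in> cluster_A s" and u: "g \<ii> = (\<lambda>j. exp (u $ j))" for g u
  proof -
    have "laurent_eval (laurent_expr \<ii> F) (g (\<gamma> \<ii>)) = laurent_eval (laurent_expr (\<beta> \<gamma>) F) (g \<ii>)"
      if \<gamma>: "\<gamma> \<in> G" and F: "F \<in> \<Lambda>" for \<gamma> F
      using laurent_eval_chart_independent[OF U[OF F] i \<beta>(1)[OF \<gamma>] pullback_in_cluster_A[OF _ g, of \<gamma>]]
        \<gamma> i \<beta>[OF \<gamma>] subgroup.subset[OF G] by (auto simp: pullback_def)
    then have "\<Phi> g = (\<Sum>\<gamma>\<in>G. \<Sum>F\<in>\<Lambda>. laurent_eval (laurent_expr (\<beta> \<gamma>) F) (g \<ii>))"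
      unfolding \<Phi>_def by (intro sum.cong refl) auto
    also have "\<dots> = (\<Sum>p\<in>G\<times>\<Lambda>. \<Sum>\<alpha>\<in>Poly_Mapping.keys (laurent_expr (\<beta> (fst p)) (snd p)).
        c (p, \<alpha>) * exp (a (p, \<alpha>) \<bullet> u))"
      by (simp add: sum.cartesian_product u laurent_eval_exp c_def a_def case_prod_beta)
    also have "\<dots> = (\<Sum>t\<in>T. c t * exp (a t \<bullet> u))"
      unfolding T_def using finG \<Lambda>(1) by (subst sum.Sigma) (auto simp: case_prod_beta)
    finally show ?thesis .
  qed
  have "\<exists>u. \<forall>v. v \<noteq> u \<longrightarrow> (\<Sum>t\<in>T. c t * exp (a t \<bullet> u)) < (\<Sum>t\<in>T. c t * exp (a t \<bullet> v))"
  proof (rule exponential_sum_has_strict_minimum[OF _ _ _ S(2)])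
    show "finite T" unfolding T_def using finG \<Lambda>(1) by auto
    show "0 < c t" if "t \<in> T" for t
      using that \<beta>(1) \<Lambda>(2) by (auto simp: T_def c_def upper_cluster_algebra_pos_def)
    show "S \<subseteq> a ` T"
    proof
      fix z assume "z \<in> S"
      then obtain F \<alpha> where F: "F \<in> \<Lambda>" "\<alpha> \<in> Poly_Mapping.keys (laurent_expr \<ii> F)" "z = (\<chi> j. real_of_int (\<alpha> j))"
        using S(1) by (auto simp: Supp_def)
      then have "(((\<lambda>x\<in>s. x), F), \<alpha>) \<in> T" using one by (simp add: T_def \<beta>_one)
      then show "z \<in> a ` T" using F(3) by (force simp: a_def)
    qed
  qed
  then obtain u where u: "\<And>v. v \<noteq> u \<Longrightarrow> (\<Sum>t\<in>T. c t * exp (a t \<bullet> u)) < (\<Sum>t\<in>T. c t * exp (a t \<bullet> v))"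
    by blast
  obtain x where x: "x \<in> cluster_A s" "x \<ii> = (\<lambda>j. exp (u $ j))"
    using chart_surj[OF i, of "\<lambda>j. exp (u $ j)"] by auto
  have uniq: "g = x" if g: "g \<in> cluster_A s" and le: "\<Phi> g \<le> \<Phi> x" for g
  proof -
    define v where "v = (\<chi> j. ln (g \<ii> j))"
    have gv: "g \<ii> = (\<lambda>j. exp (v $ j))"
      using cluster_A_orthant[OF g i] by (auto simp: v_def)
    have "v = u" using u[of v] le \<Phi>_exp[OF g gv] \<Phi>_exp[OF x] by fastforce
    then show ?thesis using cluster_A_eqI[OF g x(1) i] gv x(2) by simp
  qed
  \<comment> \<open>left translation by \<open>\<delta>\<close> is injective on the finite set \<open>G\<close>, so it only permutes the summands\<close>
  have "\<Phi> (pullback s \<delta> x) = \<Phi> x" if \<delta>: "\<delta> \<in> G" for \<delta>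
  proof -
    have closed: "compose s \<delta> \<gamma> \<in> G" if "\<gamma> \<in> G" for \<gamma>
      using subgroup.m_closed[OF G \<delta> that] GD(1)[OF \<delta>] GD(1)[OF that]
      by (simp add: cluster_modular_group_def BijGroup_def)
    have inj: "inj_on (compose s \<delta>) G"
    proof (rule inj_onI)
      fix \<gamma> \<gamma>' assume *: "\<gamma> \<in> G" "\<gamma>' \<in> G" "compose s \<delta> \<gamma> = compose s \<delta> \<gamma>'"
      show "\<gamma> = \<gamma>'"
      proof (rule extensionalityI)
        show "\<gamma> \<in> extensional s" "\<gamma>' \<in> extensional s" using GD(1) * by (auto intro: Bij_imp_extensional)
        fix \<jj> assume j: "\<jj> \<in> s"
        have "\<delta> (\<gamma> \<jj>) = \<delta> (\<gamma>' \<jj>)" using fun_cong[OF *(3), of \<jj>] j by (simp add: compose_def)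
        then show "\<gamma> \<jj> = \<gamma>' \<jj>"
          using GD(1)[OF \<delta>] GD(2)[OF *(1) j] GD(2)[OF *(2) j] by (auto simp: Bij_def bij_betw_def dest: inj_onD)
      qed
    qed
    have "compose s \<delta> ` G = G" using closed by (intro endo_inj_surj finG inj) auto
    then have "\<Phi> x = (\<Sum>\<gamma>\<in>compose s \<delta> ` G. \<Sum>F\<in>\<Lambda>. laurent_eval (laurent_expr \<ii> F) (x (\<gamma> \<ii>)))"
      by (simp add: \<Phi>_def)
    also have "\<dots> = \<Phi> (pullback s \<delta> x)"
      unfolding sum.reindex[OF inj] using GD(2) i by (simp add: \<Phi>_def pullback_def compose_def)
    finally show ?thesis by simp
  qed
  then show ?thesis
    using uniq[OF pullback_in_cluster_A[OF _ x(1)]] x(1) subgroup.subset[OF G] by (intro bexI[of _ x]) auto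
qed

theorem theorem1:
  fixes d :: "'i::finite \<Rightarrow> nat"
    and s :: "('i, 'a::field_char_0, 'x::field_char_0) seed set"
    and \<Lambda> :: "'a set"
    and G :: "(('i, 'a, 'x) seed \<Rightarrow> ('i, 'a, 'x) seed) set"
  assumes "\<And>i. 0 < d i"
    and "s \<in> mutation_classes d"
    and "filling_set s \<Lambda>"
    and "subgroup G (cluster_modular_group s)"
    and "finite G"
  shows "(\<exists>x\<in>cluster_A s. \<forall>\<gamma>\<in>G. modular_action s \<gamma> x = x) \<and>
    ensemble_map s ` cluster_A s \<subseteq> cluster_X s \<and>
    (\<exists>y\<in>ensemble_map s ` cluster_A s. \<forall>\<gamma>\<in>G. modular_action s \<gamma> y = y)"
proof -
  interpret mutation_class d s by unfold_locales (use assms in auto)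
  obtain x where x: "x \<in> cluster_A s" "\<And>\<gamma>. \<gamma> \<in> G \<Longrightarrow> pullback s \<gamma> x = x"
    using exists_pullback_invariant_point[OF assms(3-5)] by blast
  have inv: "x (\<gamma> \<ii>) = x \<ii>" if "\<gamma> \<in> G" "\<ii> \<in> s" for \<gamma> \<ii>
    using fun_cong[OF x(2)[OF that(1)], of \<ii>] that(2) by (simp add: pullback_def)
  note GD = carrier_modular_groupD[OF subsetD[OF subgroup.subset[OF assms(4)]]]
  have "modular_action s \<gamma> x = x" if "\<gamma> \<in> G" for \<gamma>
    using x(1) inv that GD(1) by (intro modular_action_eq_self) (auto simp: cluster_A_def PiE_def)
  moreover have "modular_action s \<gamma> (ensemble_map s x) = ensemble_map s x" if \<gamma>: "\<gamma> \<in> G" for \<gamma>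
    using inv[OF \<gamma>] GD(2,3)[OF \<gamma>]
    by (intro modular_action_eq_self GD(1)[OF \<gamma>]) (auto simp: ensemble_map_def)
  ultimately show ?thesis using x(1) ensemble_map_in_cluster_X by blast
qed

end
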